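(* Let $R>0$ and let $S\subset\mathbb{R}^3$ be a nonempty compact set whose volume function satisfies $$V(r;S)=\mu(S)+L_0 r+Mr^2+\tfrac{4}{3}\pi r^3,\qquad 0\le r<R,$$ for some constants $L_0,M$. Let $D_1,\dots,D_n$ be an i.i.d. sample of the distance variable $D=\mathcal{D}(X,S)$, where $X$ is uniformly distributed on $B(S,R)\setminus S$, and let $\overline D=\frac1n\sum_{i=1}^n D_i$, $\overline{D^2}=\frac1n\sum_{i=1}^n D_i^2$. Then the estimators of $L_0$ and $M$ by the method of moments are $$\tilde L_0=\frac{2\pi R^2}{5}\left[\frac{3R^2-12\overline D R+10\overline{D^2}}{R^2-6\overline D R+6\overline{D^2}}\right],\qquad \tilde M=-\frac{4\pi R}{5}\left[\frac{3R^2-16\overline D R+15\overline{D^2}}{R^2-6\overline D R+6\overline{D^2}}\right].$$ Moreover, denoting $$g_1(u,v)=\frac{2\pi R^2}{5}\left[\frac{3R^2-12uR+10v}{R^2-6uR+6v}\right],\qquad g_2(u,v)=-\frac{4\pi R}{5}\left[\frac{3R^2-16uR+15v}{R^2-6uR+6v}\right],$$ we have, as $n\to\infty$, $$\sqrt n(\tilde L_0-L_0)\to N(0,\sigma^2_{\tilde L_0})\ \text{ in law}\quad\text{and}\quad \sqrt n(\tilde M-M)\to N(0,\sigma^2_{\tilde M})\ \text{ in law},$$ with $\sigma^2_{\tilde L_0}=\nabla g_1^{t}\,\Sigma_{D,D^2}\,\nabla g_1$ and $\sigma^2_{\tilde M}=\nabla g_2^{t}\,\Sigma_{D,D^2}\,\nabla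 g_2$, where the gradients are evaluated at $(\mathbb{E}(D),\mathbb{E}(D^2))$ and $\Sigma_{D,D^2}$ is the covariance matrix of the vector $(D,D^2)$, whose elements are $$\mathrm{Var}(D)=\frac{R^2(12\pi^2R^4+24\pi MR^3+10M^2R^2+44\pi L_0R^2+30L_0MR+15L_0^2)}{20(4\pi R^2+3MR+3L_0)^2},$$ $$\mathrm{Var}(D^2)=\frac{R^4(768\pi^2R^4+1360\pi MR^3+525M^2R^2+1920\pi L_0R^2+1260L_0MR+560L_0^2)}{700(4\pi R^2+3MR+3L_0)^2},$$ $$\mathrm{Cov}(D,D^2)=\frac{R^3(16\pi^2R^4+30\pi MR^3+12M^2R^2+48\pi L_0R^2+32L_0MR+15L_0^2)}{20(4\pi R^2+3MR+3L_0)^2}.$$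
   Context: For $x\in\mathbb{R}^3$, $\mathcal{D}(x,S)=\inf_{y\in S}\|x-y\|$ is the Euclidean distance to $S$; $B(S,r)=\{x:\mathcal{D}(x,S)\le r\}$ is the closed $r$-parallel set; $\mu$ is Lebesgue measure on $\mathbb{R}^3$; $V(r;S)=\mu(B(S,r))$ is the volume function of $S$. The quantity $R$ is known, and $L_0$ and $M$ are the unknown parameters. The estimators of $L_0$ and $M$ by the method of moments are the solutions in $(L_0,M)$ of the system $\overline D=\mathbb{E}(D)$, $\overline{D^2}=\mathbb{E}(D^2)$, where $\mathbb{E}(D)$ and $\mathbb{E}(D^2)$ are regarded as functions of $(L_0,M)$ (with $R$ fixed). They are defined whenever $R^2-6\overline D R+6\overline{D^2}\neq 0$, which holds almost surely. *)

theory Defs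
  imports "HOL-Probability.Probability"
begin

definition parallel_set :: "'a::metric_space set \<Rightarrow> real \<Rightarrow> 'a set" where
  "parallel_set S r = {x. infdist x S \<le> r}"

definition volume_function :: "'a::euclidean_space set \<Rightarrow> real \<Rightarrow> real" where
  "volume_function S r = measure lborel (parallel_set S r)"


subsection \<open>Parametric model for the distance variable\<close>

text \<open>
  If \<open>V(r; S) = \<mu>(S) + L r + M r\<^sup>2 + 4/3 \<pi> r\<^sup>3\<close> for \<open>0 \<le> r < R\<close> and \<open>X\<close> is uniform on
  \<open>B(S, R) \<setminus> S\<close>, then the distance of \<open>X\<close> to \<open>S\<close> has distribution function
  \<open>(V(r; S) - \<mu>(S)) / (V(R; S) - \<mu>(S))\<close> on \<open>[0, R]\<close>.  Differentiating gives a density that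
  depends on \<open>(L, M)\<close> only, and makes the moments functions of \<open>(L, M)\<close>.  As functions of the
  parameters they make sense whenever the normalising constant is nonzero, even if
  \<open>(L, M)\<close> does not come from any set.
\<close>

definition volume_increment :: "real \<Rightarrow> real \<Rightarrow> real \<Rightarrow> real" where
  "volume_increment L M r = L * r + M * r^2 + 4/3 * pi * r^3"

definition model_cdf :: "real \<Rightarrow> real \<Rightarrow> real \<Rightarrow> real \<Rightarrow> real" where
  "model_cdf R L M r = volume_increment L M r / volume_increment L M R"

definition model_density :: "real \<Rightarrow> real \<Rightarrow> real \<Rightarrow> real \<Rightarrow> real" where
  "model_density R L M r = deriv (model_cdf R L M) r"

definition model_moment :: "real \<Rightarrow> nat \<Rightarrow> real \<Rightarrow> real \<Rightarrow> real" where
  "model_moment R k L M = integral {0..R} (\<lambda>r. r^k * model_density R L M r)"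


subsection \<open>Method of moments\<close>

text \<open>The arguments \<open>u\<close> and \<open>v\<close> below stand for the first two sample moments.\<close>

definition moment_system :: "real \<Rightarrow> real \<Rightarrow> real \<Rightarrow> real \<times> real \<Rightarrow> bool" where
  "moment_system R u v = (\<lambda>(L, M). volume_increment L M R \<noteq> 0 \<and>
     u = model_moment R 1 L M \<and> v = model_moment R 2 L M)"

text \<open>The value \<open>(0, 0)\<close> is an arbitrary choice for samples at which the estimator is undefined.\<close>

definition moment_estimator :: "real \<Rightarrow> real \<Rightarrow> real \<Rightarrow> real \<times> real" where
  "moment_estimator R u v =
     (if \<exists>!p. moment_system R u v p then THE p. moment_system R u v p else (0, 0))"

definition sample_mean :: "(nat \<Rightarrow> 'a \<Rightarrow> real) \<Rightarrow> nat \<Rightarrow> 'a \<Rightarrow> real" where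
  "sample_mean Y n \<omega> = (\<Sum>i<n. Y i \<omega>) / real n"

definition g1 :: "real \<Rightarrow> real \<Rightarrow> real \<Rightarrow> real" where
  "g1 R u v = 2 * pi * R^2 / 5 *
     ((3 * R^2 - 12 * u * R + 10 * v) / (R^2 - 6 * u * R + 6 * v))"

definition g2 :: "real \<Rightarrow> real \<Rightarrow> real \<Rightarrow> real" where
  "g2 R u v = - (4 * pi * R / 5) *
     ((3 * R^2 - 16 * u * R + 15 * v) / (R^2 - 6 * u * R + 6 * v))"


subsection \<open>Gradients, covariances and normal laws\<close>

text \<open>Only meaningful at points where \<open>f\<close> is differentiable.\<close>

definition gradient :: "('a::real_inner \<Rightarrow> real) \<Rightarrow> 'a \<Rightarrow> 'a" where
  "gradient f x = (THE d. GDERIV f x :> d)"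

lemma gradient_eqI:
  assumes "GDERIV f x :> d"
  shows "gradient f x = d"
  unfolding gradient_def
proof (rule the_equality)
  show "GDERIV f x :> d" by (fact assms)
next
  fix e assume "GDERIV f x :> e"
  with assms have "(\<lambda>h. h \<bullet> e) = (\<lambda>h. h \<bullet> d)"
    unfolding gderiv_def by (rule has_derivative_unique[rotated])
  then have "(e - d) \<bullet> e = (e - d) \<bullet> d" by meson
  then have "(e - d) \<bullet> (e - d) = 0" by (simp add: inner_diff_right)
  then show "e = d" by simp
qed

definition covariance :: "'a measure \<Rightarrow> ('a \<Rightarrow> real) \<Rightarrow> ('a \<Rightarrow> real) \<Rightarrow> real" where
  "covariance P X Y = prob_space.expectation P
     (\<lambda>\<omega>. (X \<omega> - prob_space.expectation P X) * (Y \<omega> - prob_space.expectation P Y))"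

definition covariance_matrix :: "'a measure \<Rightarrow> ('a \<Rightarrow> real ^ 'n) \<Rightarrow> real ^ 'n ^ 'n" where
  "covariance_matrix P Z = (\<chi> i j. covariance P (\<lambda>\<omega>. Z \<omega> $ i) (\<lambda>\<omega>. Z \<omega> $ j))"

text \<open>The second parameter is the variance; a zero variance gives the point mass.\<close>

definition normal_law :: "real \<Rightarrow> real \<Rightarrow> real measure" where
  "normal_law m s2 =
     (if s2 = 0 then return borel m else density lborel (normal_density m (sqrt s2)))"

end

(*
  The level set {infdist = R} is a Lipschitz image of a subset of {infdist = R/2}, which is null
  because the volume function is continuous at R/2; hence the polynomial formula for the volume extends to
  r = R, and D has the quadratic density of the parametric model on [0, R].  All moments are then
  rational in L and M.  The moment equations, multiplied by the normalising constant, are linear in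
  (L, M); since R^2 - 6xR + 6x^2 is orthogonal on [0, R] to polynomials of degree at most one, the
  denominator of the estimators times that constant is 2 pi R^5 / 15 at any solution, so it never
  vanishes there.  For samples it is almost surely nonzero because D has no atoms.  The estimators
  are linear fractional in the sample moments, so the delta method reduces to the central limit
  theorem for a sum and Slutsky's theorem for its quotient by a sample mean.
*)
theory Submission
  imports Defs
begin

subsection \<open>Level sets of the distance function\<close>

text \<open>Two points shape the argument. The volume formula is given only for radii below
  \<open>R\<close>, while \<open>X\<close> may lie at distance exactly \<open>R\<close>; without
  control of that level set the law of the distance could have an atom there. Hence the detour
  through the level \<open>R / 2\<close>.

  The brackets in the estimators are, up to scale, the basis dual to 1, r, r^2 for integration over
  [0, R]: 3R^2 - 12Rr + 10r^2 is orthogonal to r and r^2, 3R^2 - 16Rr + 15r^2 to 1 and r^2, and the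
  shifted Legendre polynomial R^2 - 6Rr + 6r^2 to 1 and r. Integrated against the unnormalised
  density L + 2Mr + 4 pi r^2 they isolate L, M and the known leading coefficient 4 pi. In the
  quotients the normalising constant cancels, which leaves L and M. The constant 2 pi R^5 / 15 is 4
  pi times R^5 / 30, the integral of r^2 (R^2 - 6Rr + 6r^2).\<close>

lemma closed_parallel_set: "closed (parallel_set S r)"
  unfolding parallel_set_def by (intro closed_Collect_le continuous_intros)

lemma bounded_parallel_set:
  fixes S :: "'a::euclidean_space set"
  assumes "compact S" and "S \<noteq> {}"
  shows "bounded (parallel_set S r)"
proof -
  obtain B where B: "\<And>y. y \<in> S \<Longrightarrow> norm y \<le> B"
    using compact_imp_bounded [OF assms(1)] by (auto simp: bounded_iff)
  have "norm x \<le> B + r" if "x \<in> parallel_set S r" for x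
  proof -
    obtain y where "y \<in> S" "infdist x S = dist x y"
      using infdist_attains_inf compact_imp_closed assms by metis
    then have "dist x y \<le> r" using that by (simp add: parallel_set_def)
    then show ?thesis
      using B [OF \<open>y \<in> S\<close>] norm_triangle_sub [of x y] by (simp add: dist_norm)
  qed
  then show ?thesis by (auto simp: bounded_iff)
qed

lemma fmeasurable_parallel_set:
  fixes S :: "'a::euclidean_space set"
  assumes "compact S" and "S \<noteq> {}"
  shows "parallel_set S r \<in> fmeasurable lborel"
  using bounded_parallel_set [OF assms] closed_parallel_set
  by (intro fmeasurable_compact) (simp add: compact_eq_bounded_closed)

lemma parallel_set_0:
  assumes "closed S" and "S \<noteq> {}"
  shows "parallel_set S 0 = S"
proof -
  have "infdist x S \<le> 0 \<longleftrightarrow> infdist x S = 0" for x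
    using infdist_nonneg [of x S] by linarith
  then show ?thesis
    unfolding parallel_set_def using in_closed_iff_infdist_zero [OF assms] by (simp add: set_eq_iff)
qed

text \<open>Meant for \<open>y\<close>, \<open>y'\<close> nearest to \<open>x\<close>,
  \<open>x'\<close> in \<open>S\<close>. With \<open>a\<close>, \<open>b\<close>, \<open>e\<close>,
  \<open>d\<close> as in the proof, squaring the hypotheses bounds
  \<open>-2 * (a \<bullet> e)\<close> and \<open>2 * (b \<bullet> e)\<close> by
  \<open>e \<bullet> e\<close>. Expanding the square of \<open>2d = 2e - (b - a)\<close> then gives
  |b - a| \<le> 2|d|, and the triangle inequality gives 2|e| \<le> 4|d|.\<close>

lemma norm_diff_le_midpoints:
  fixes x x' y y' :: "'a::real_inner"
  assumes "norm (x - y) \<le> norm (x' - y)" and "norm (x' - y') \<le> norm (x - y')"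
  shows "norm (x' - x) \<le> 2 * norm (midpoint x' y' - midpoint x y)"
proof -
  define a b e d where "a = x - y" and "b = x' - y'" and "e = x' - x"
    and "d = midpoint x' y' - midpoint x y"
  have d: "2 *\<^sub>R d = 2 *\<^sub>R e - (b - a)"
    by (simp add: d_def a_def b_def e_def midpoint_def algebra_simps)
       (simp add: scaleR_2)
  have "(norm a)\<^sup>2 \<le> (norm (a + e))\<^sup>2"
    using assms(1) by (intro power_mono) (simp_all add: a_def e_def)
  then have 1: "0 \<le> 2 * (a \<bullet> e) + e \<bullet> e"
    by (simp add: power2_norm_eq_inner inner_simps inner_commute)
  have "(norm b)\<^sup>2 \<le> (norm (b - e))\<^sup>2"
    using assms(2) by (intro power_mono) (simp_all add: b_def e_def)
  then have 2: "2 * (b \<bullet> e) \<le> e \<bullet> e"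
    by (simp add: power2_norm_eq_inner inner_simps inner_commute)
  have "(norm (2 *\<^sub>R d))\<^sup>2 = 4 * (e \<bullet> e) - 4 * (b \<bullet> e) + 4 * (a \<bullet> e) + (norm (b - a))\<^sup>2"
    unfolding d by (simp add: power2_norm_eq_inner inner_simps inner_commute)
  then have "(norm (b - a))\<^sup>2 \<le> (norm (2 *\<^sub>R d))\<^sup>2" using 1 2 by linarith
  then have "norm (b - a) \<le> 2 * norm d"
    using power2_le_imp_le [of "norm (b - a)" "norm (2 *\<^sub>R d)"] by simp
  moreover have "2 * norm e = norm (2 *\<^sub>R d + (b - a))" by (simp add: d)
  ultimately have "2 * norm e \<le> 2 * norm d + 2 * norm d"
    using norm_triangle_ineq [of "2 *\<^sub>R d" "b - a"] by simp
  then show ?thesis by (simp add: e_def d_def)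
qed

text \<open>Moving each point halfway towards a nearest point of \<open>S\<close> is a map between the two level
  sets whose inverse is 2-Lipschitz.\<close>

lemma negligible_infdist_level_double:
  fixes S :: "'a::euclidean_space set"
  assumes "closed S" and "S \<noteq> {}" and negl: "negligible {x. infdist x S = r}"
  shows "negligible {x. infdist x S = 2 * r}"
proof -
  define T where "T = {x. infdist x S = 2 * r}"
  obtain p where p: "p x \<in> S" "infdist x S = dist x (p x)" for x
  proof -
    have "\<exists>p. \<forall>x. p x \<in> S \<and> infdist x S = dist x (p x)"
      using infdist_attains_inf [OF assms(1,2)] by (intro choice) blast
    then show thesis using that by blast
  qed
  define m where "m x = midpoint x (p x)" for x
  have lip: "norm (x' - x) \<le> 2 * norm (m x' - m x)" if "x \<in> T" "x' \<in> T" for x x'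
    unfolding m_def
  proof (rule norm_diff_le_midpoints)
    have eq: "dist x (p x) = 2 * r" "dist x' (p x') = 2 * r"
      using that p(2) [of x] p(2) [of x'] by (auto simp: T_def)
    \<comment> \<open>Both points lie at distance \<open>2 * r\<close> from \<open>S\<close>, so the
      foot of either one is at least that far from the other.\<close>
    show "norm (x - p x) \<le> norm (x' - p x)"
      using infdist_le [OF p(1), of x' x] that(2) eq by (simp add: T_def dist_norm)
    show "norm (x' - p x') \<le> norm (x - p x')"
      using infdist_le [OF p(1), of x x'] that(1) eq by (simp add: T_def dist_norm)
  qed
  have "inj_on m T"
  proof (rule inj_onI)
    fix x x' assume "x \<in> T" "x' \<in> T" "m x = m x'"
    then show "x = x'" using lip [of x x'] by simp
  qed
  define h where "h = inv_into T m"
  have h: "h (m x) = x" if "x \<in> T" for x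
    using \<open>inj_on m T\<close> that by (simp add: h_def)
  have "m ` T \<subseteq> {x. infdist x S = r}"
  proof (clarify)
    fix x assume "x \<in> T"
    then have "dist x (p x) = 2 * r" using p(2) [of x] by (simp add: T_def)
    then have "dist (m x) (p x) = r" "dist x (m x) = r"
      by (simp_all add: m_def dist_midpoint)
    \<comment> \<open>The midpoint is within \<open>r\<close> of \<open>S\<close> because of
      \<open>p x\<close>, and no closer, since \<open>infdist\<close> is 1-Lipschitz and
      \<open>x\<close> is at distance \<open>2 * r\<close>.\<close>
    then show "infdist (m x) S = r"
      using infdist_le [OF p(1), of "m x" x] infdist_triangle [of x S "m x"] \<open>x \<in> T\<close>
      by (simp add: T_def)
  qed
  then have "negligible (m ` T)" using negl negligible_subset by blast
  then have "negligible (h ` (m ` T))"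
  proof (rule negligible_locally_Lipschitz_image [OF order_refl])
    fix z assume "z \<in> m ` T"
    then obtain x where "x \<in> T" "z = m x" by auto
    then have "\<forall>z'\<in>m ` T \<inter> UNIV. norm (h z' - h z) \<le> 2 * norm (z' - z)"
      using lip h by auto
    then show "\<exists>U B. open U \<and> z \<in> U \<and> (\<forall>z'\<in>m ` T \<inter> U. norm (h z' - h z) \<le> B * norm (z' - z))"
      using open_UNIV by blast
  qed
  moreover have "h ` (m ` T) = T" using h by (simp add: image_image)
  ultimately show ?thesis by (simp add: T_def)
qed

text \<open>The level set lies in every shell \<open>parallel_set S s - parallel_set S t\<close>
  with \<open>t < s\<close>. The measure of the shell is a difference of volumes, which left
  continuity makes arbitrarily small.\<close>

lemma negligible_infdist_level:
  fixes S :: "'a::euclidean_space set"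
  assumes "compact S" and "S \<noteq> {}"
    and lim: "(volume_function S \<longlongrightarrow> volume_function S s) (at_left s)"
  shows "negligible {x. infdist x S = s}"
proof -
  let ?L = "{x. infdist x S = s}"
  have L: "?L \<in> fmeasurable lborel"
  proof (rule fmeasurableI2 [OF fmeasurable_parallel_set [OF assms(1,2), of s]])
    show "?L \<subseteq> parallel_set S s" by (auto simp: parallel_set_def)
    have "closed ?L" by (intro closed_Collect_eq continuous_intros)
    then show "?L \<in> sets lborel" by simp
  qed
  have le: "measure lborel ?L \<le> volume_function S s - volume_function S t" if "t < s" for t
  proof -
    have "measure lborel ?L \<le> measure lborel (parallel_set S s - parallel_set S t)"
      using that L fmeasurable_parallel_set [OF assms(1,2)]
      by (intro measure_mono_fmeasurable) (auto simp: parallel_set_def)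
    also have "\<dots> = volume_function S s - volume_function S t"
      unfolding volume_function_def using that fmeasurable_parallel_set [OF assms(1,2)]
      by (intro measurable_measure_Diff fmeasurableD) (auto simp: parallel_set_def)
    finally show ?thesis .
  qed
  have "((\<lambda>t. volume_function S s - volume_function S t) \<longlongrightarrow> volume_function S s - volume_function S s) (at_left s)"
    by (intro tendsto_intros lim)
  then have "measure lborel ?L \<le> volume_function S s - volume_function S s"
    by (rule tendsto_lowerbound)
       (auto simp: eventually_at_left_field intro!: exI [of _ "s - 1"] le)
  then have "measure lborel ?L = 0" using measure_nonneg [of lborel ?L] by simp
  then have "?L \<in> null_sets lborel"
    using L by (intro null_setsI fmeasurableD) (simp_all add: emeasure_eq_measure2)
  then show ?thesis by (simp add: negligible_iff_null_sets null_sets_completionI)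
qed

text \<open>Parallel sets of smaller radius exhaust \<open>parallel_set S R\<close> up to the level
  set at \<open>R\<close>, so by continuity from below only that level set could make the volume
  jump.\<close>

lemma volume_function_right_endpoint:
  fixes S :: "'a::euclidean_space set"
  assumes "compact S" and "S \<noteq> {}" and "R > 0" and cont: "continuous_on UNIV f"
    and vol: "\<And>r. 0 \<le> r \<Longrightarrow> r < R \<Longrightarrow> volume_function S r = f r"
  shows "volume_function S R = f R"
proof -
  let ?N = "{x. infdist x S = R}"
  have isCont_f: "isCont f x" for x
    using cont by (simp add: continuous_on_eq_continuous_at)
  have "(f \<longlongrightarrow> f (R / 2)) (at_left (R / 2))"
    by (rule tendsto_mono [OF at_le [OF subset_UNIV] isContD [OF isCont_f]])
  then have "(volume_function S \<longlongrightarrow> f (R / 2)) (at_left (R / 2))"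
  proof (rule Lim_transform_eventually)
    have "\<forall>\<^sub>F r in at_left (R / 2). r \<in> {0<..<R / 2}"
      using \<open>R > 0\<close> by (intro eventually_at_left_real) simp
    then show "\<forall>\<^sub>F r in at_left (R / 2). f r = volume_function S r"
      by eventually_elim (use \<open>R > 0\<close> in \<open>simp add: vol\<close>)
  qed
  then have "negligible {x. infdist x S = R / 2}"
    using assms(1-3) by (intro negligible_infdist_level) (simp_all add: vol)
  then have "negligible ?N"
    using negligible_infdist_level_double [OF compact_imp_closed, of S "R / 2"] assms(1,2)
    by simp
  moreover have "closed ?N" by (intro closed_Collect_eq continuous_intros)
  ultimately have N: "?N \<in> null_sets lborel"
    by (auto simp: negligible_iff_null_sets null_sets_completion_iff)
  \<comment> \<open>Here \<open>t 0 = 0\<close>, so every term lies in the range where the volume is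
    given.\<close>
  define t where "t n = R - R / real (Suc n)" for n
  have t: "0 \<le> t n" "t n < R" for n
    using \<open>R > 0\<close> by (auto simp: t_def field_simps)
  have t_lim: "t \<longlonglongrightarrow> R"
  proof -
    have "(\<lambda>n. R - R * (1 / real (Suc n))) \<longlonglongrightarrow> R - R * 0"
      by (intro tendsto_intros LIMSEQ_Suc [OF lim_1_over_n])
    then show ?thesis by (simp add: t_def [abs_def])
  qed
  have "incseq t"
    using \<open>R > 0\<close> by (intro incseq_SucI) (simp add: t_def field_simps)
  then have inc: "incseq (\<lambda>n. parallel_set S (t n))"
    by (fastforce simp: incseq_def parallel_set_def)
  have Un: "(\<Union>n. parallel_set S (t n)) = parallel_set S R - ?N"
  proof (intro equalityI subsetI)
    fix x assume "x \<in> (\<Union>n. parallel_set S (t n))"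
    then obtain n where "infdist x S \<le> t n" by (auto simp: parallel_set_def)
    then show "x \<in> parallel_set S R - ?N" using t(2) [of n] by (simp add: parallel_set_def)
  next
    fix x assume "x \<in> parallel_set S R - ?N"
    then have "infdist x S < R" by (simp add: parallel_set_def)
    then have "\<forall>\<^sub>F n in sequentially. infdist x S < t n" using t_lim order_tendstoD(1) by blast
    then obtain n where "infdist x S < t n" by (auto simp: eventually_sequentially)
    then show "x \<in> (\<Union>n. parallel_set S (t n))" by (auto simp: parallel_set_def intro: less_imp_le)
  qed
  have fm: "parallel_set S r \<in> fmeasurable lborel" for r
    by (rule fmeasurable_parallel_set [OF assms(1,2)])
  have "(\<lambda>n. measure lborel (parallel_set S (t n))) \<longlonglongrightarrow> measure lborel (\<Union>n. parallel_set S (t n))"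
  proof (rule Lim_measure_incseq)
    show "range (\<lambda>n. parallel_set S (t n)) \<subseteq> sets lborel" using fm by (auto simp: fmeasurable_def)
    show "emeasure lborel (\<Union>n. parallel_set S (t n)) \<noteq> \<infinity>"
      unfolding Un using fmeasurable_Diff [OF fm, of ?N R] N by (auto simp: fmeasurable_def)
  qed (rule inc)
  also have "measure lborel (\<Union>n. parallel_set S (t n)) = volume_function S R"
    unfolding Un volume_function_def using N fm [of R] by (intro measure_Diff_null_set) auto
  finally have "(\<lambda>n. f (t n)) \<longlonglongrightarrow> volume_function S R"
    using vol [OF t] by (simp flip: volume_function_def)
  moreover have "(\<lambda>n. f (t n)) \<longlonglongrightarrow> f R"
    by (rule isCont_tendsto_compose [OF isCont_f t_lim])
  ultimately show ?thesis by (rule LIMSEQ_unique)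
qed

subsection \<open>The law of the distance variable\<close>

lemma volume_increment_has_real_derivative:
  "(volume_increment L M has_real_derivative L + 2 * M * r + 4 * pi * r\<^sup>2) (at r)"
  unfolding volume_increment_def by (auto intro!: derivative_eq_intros)

lemma model_density_eq:
  "model_density R L M r = (L + 2 * M * r + 4 * pi * r\<^sup>2) / volume_increment L M R"
  unfolding model_density_def model_cdf_def
  by (intro DERIV_imp_deriv DERIV_cdivide volume_increment_has_real_derivative)

text \<open>The antiderivative of \<open>r ^ k * model_density R L M r\<close> that vanishes at 0.
  It serves the distribution function (\<open>k = 0\<close>) and the moments (\<open>r = R\<close>)
  alike.\<close>

definition partial_moment :: "real \<Rightarrow> nat \<Rightarrow> real \<Rightarrow> real \<Rightarrow> real \<Rightarrow> real" where
  "partial_moment R k L M r =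
     (L * r ^ (k + 1) / real (k + 1) + 2 * M * r ^ (k + 2) / real (k + 2)
       + 4 * pi * r ^ (k + 3) / real (k + 3)) / volume_increment L M R"

lemma partial_moment_has_real_derivative:
  "(partial_moment R k L M has_real_derivative r ^ k * model_density R L M r) (at r)"
proof -
  have power: "((\<lambda>r. r ^ Suc m / real (Suc m)) has_real_derivative r ^ m) (at r)" for m
    by (rule derivative_eq_intros refl | simp)+
  have "((\<lambda>r. (L * (r ^ Suc k / real (Suc k)) + 2 * M * (r ^ Suc (k + 1) / real (Suc (k + 1)))
       + 4 * pi * (r ^ Suc (k + 2) / real (Suc (k + 2)))) / volume_increment L M R)
    has_real_derivative (L * r ^ k + 2 * M * r ^ (k + 1) + 4 * pi * r ^ (k + 2)) / volume_increment L M R) (at r)"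
    by (intro DERIV_cdivide DERIV_add DERIV_cmult power)
  then show ?thesis
    by (simp add: partial_moment_def [abs_def] model_density_eq power_add algebra_simps
        power2_eq_square numeral_3_eq_3)
qed

lemma partial_moment_0 [simp]: "partial_moment R k L M 0 = 0"
  by (simp add: partial_moment_def)

lemma model_moment_eq:
  assumes "R \<ge> 0"
  shows "model_moment R k L M = partial_moment R k L M R"
proof -
  have "((\<lambda>r. r ^ k * model_density R L M r) has_integral
      partial_moment R k L M R - partial_moment R k L M 0) {0..R}"
    using assms partial_moment_has_real_derivative
    by (intro fundamental_theorem_of_calculus)
       (auto intro: has_field_derivative_at_within simp flip: has_real_derivative_iff_has_vector_derivative)
  then show ?thesis by (simp add: model_moment_def integral_unique)
qed

lemma partial_moment_eq_cdf: "partial_moment R 0 L M r = model_cdf R L M r"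
  by (simp add: partial_moment_def model_cdf_def volume_increment_def power2_eq_square power3_eq_cube)

text \<open>\<open>ennreal\<close> truncates negative values to 0. Under the assumptions of
  \<open>distance_model\<close> below, the density is nonnegative on [0, R] and nothing is
  lost.\<close>

definition distance_law :: "real \<Rightarrow> real \<Rightarrow> real \<Rightarrow> real measure" where
  "distance_law R L M = density lborel (\<lambda>r. ennreal (model_density R L M r * indicator {0..R} r))"

lemma borel_measurable_model_density [measurable]: "model_density R L M \<in> borel_measurable borel"
  unfolding model_density_eq [abs_def] by measurable

lemma isCont_model_density: "isCont (\<lambda>r. r ^ k * model_density R L M r) r"
  unfolding model_density_eq divide_inverse by (intro continuous_intros)

text \<open>What a volume function supplies: together, monotonicity and positivity of the increment
  make the formal density a probability density.\<close>

locale distance_model =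
  fixes R L M :: real
  assumes R_pos: "R > 0" and increment_pos: "volume_increment L M R > 0"
    and mono: "mono_on {0..R} (volume_increment L M)"
begin

lemma density_nonneg:
  assumes "0 \<le> r" "r \<le> R"
  shows "0 \<le> model_density R L M r"
proof -
  have "0 \<le> L + 2 * M * r + 4 * pi * r\<^sup>2"
  \<comment> \<open>Monotonicity controls the derivative at interior points only; the endpoints
    follow by continuity.\<close>
  proof (rule continuous_ge_on_closure [where S = "{0<..<R}" and f = "\<lambda>r. L + 2 * M * r + 4 * pi * r\<^sup>2"])
    show "continuous_on (closure {0<..<R}) (\<lambda>r. L + 2 * M * r + 4 * pi * r\<^sup>2)"
      by (intro continuous_intros)
    show "r \<in> closure {0<..<R}" using assms R_pos by simp
    fix x assume "x \<in> {0<..<R}"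
    then show "0 \<le> L + 2 * M * x + 4 * pi * x\<^sup>2"
      using mono_on_imp_deriv_nonneg [OF mono volume_increment_has_real_derivative, of x] by simp
  qed
  then show ?thesis
    using increment_pos by (simp add: model_density_eq)
qed

lemma emeasure_distance_law_atMost:
  assumes "0 \<le> r"
  shows "emeasure (distance_law R L M) {..r} = ennreal (model_cdf R L M (min r R))"
proof -
  have "emeasure (distance_law R L M) {..r}
      = (\<integral>\<^sup>+ x. ennreal (model_density R L M x * indicator {0..R} x) * indicator {..r} x \<partial>lborel)"
    unfolding distance_law_def by (subst emeasure_density) auto
  also have "\<dots> = (\<integral>\<^sup>+ x. ennreal (model_density R L M x) * indicator {0..min r R} x \<partial>lborel)"
    by (intro nn_integral_cong) (auto split: split_indicator)
  also have "\<dots> = ennreal (partial_moment R 0 L M (min r R) - partial_moment R 0 L M 0)"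
    using partial_moment_has_real_derivative [of R 0 L M] assms R_pos
    by (intro nn_integral_FTC_Icc) (auto intro: density_nonneg)
  finally show ?thesis by (simp add: partial_moment_eq_cdf)
qed

lemma emeasure_distance_law_atMost_neg:
  assumes "r < 0"
  shows "emeasure (distance_law R L M) {..r} = 0"
  unfolding distance_law_def using assms
  by (subst emeasure_density) (auto simp: nn_integral_0_iff_AE split: split_indicator)

lemma real_distribution_distance_law: "real_distribution (distance_law R L M)"
proof -
  have "emeasure (distance_law R L M) UNIV
      = (\<integral>\<^sup>+ x. ennreal (model_density R L M x * indicator {0..R} x) \<partial>lborel)"
    unfolding distance_law_def by (subst emeasure_density) auto
  also have "\<dots> = (\<integral>\<^sup>+ x. ennreal (model_density R L M x) * indicator {0..R} x \<partial>lborel)"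
    by (intro nn_integral_cong) (auto split: split_indicator)
  also have "\<dots> = ennreal (partial_moment R 0 L M R - partial_moment R 0 L M 0)"
    using partial_moment_has_real_derivative [of R 0 L M] R_pos
    by (intro nn_integral_FTC_Icc) (auto intro: density_nonneg)
  also have "\<dots> = 1" using increment_pos by (simp add: partial_moment_eq_cdf model_cdf_def)
  finally have "prob_space (distance_law R L M)"
    by (intro prob_spaceI) (simp add: distance_law_def)
  then show ?thesis
    by (simp add: real_distribution_def real_distribution_axioms_def distance_law_def)
qed

lemma has_bochner_integral_distance_law:
  "has_bochner_integral (distance_law R L M) (\<lambda>r. r ^ k) (model_moment R k L M)"
proof -
  have "has_bochner_integral lborel
      (\<lambda>r. (r ^ k * model_density R L M r) * indicator {0..R} r)
      (partial_moment R k L M R - partial_moment R k L M 0)"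
    using R_pos partial_moment_has_real_derivative isCont_model_density
    by (intro has_bochner_integral_FTC_Icc_real) auto
  then have "has_bochner_integral lborel
      (\<lambda>r. (model_density R L M r * indicator {0..R} r) *\<^sub>R r ^ k) (model_moment R k L M)"
    using R_pos by (simp add: model_moment_eq mult_ac)
  then show ?thesis
    unfolding distance_law_def
    by (intro has_bochner_integral_density) (auto split: split_indicator intro: density_nonneg)
qed

lemma finite_imp_null_set_distance_law:
  assumes "finite A"
  shows "A \<in> null_sets (distance_law R L M)"
proof -
  have "A \<in> null_sets lborel" using assms by (rule finite_imp_null_set_lborel)
  then show ?thesis
    unfolding distance_law_def
    by (rule absolutely_continuousI_density [unfolded absolutely_continuous_def, THEN subsetD, rotated]) measurable
qed

end

text \<open>The comparison is made through distribution functions: the distance is at most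
  \<open>r\<close> exactly when \<open>X\<close> lies in \<open>parallel_set S r\<close>, so its
  distribution function is a quotient of volumes.\<close>

lemma distance_distribution:
  fixes S :: "'a::euclidean_space set"
  assumes "R > 0" and S: "compact S" "S \<noteq> {}"
    and vol: "\<And>r. 0 \<le> r \<Longrightarrow> r < R \<Longrightarrow>
           volume_function S r = measure lborel S + volume_increment L M r"
    and "prob_space Q" and X: "X \<in> measurable Q lborel"
    and X_law: "distr Q lborel X = uniform_measure lborel (parallel_set S R - S)"
  shows "distance_model R L M" and "distr Q borel (\<lambda>\<omega>. infdist (X \<omega>) S) = distance_law R L M"
proof -
  interpret Q: prob_space Q by fact
  let ?A = "parallel_set S R - S"
  let ?D = "\<lambda>\<omega>. infdist (X \<omega>) S"
  have [measurable]: "X \<in> borel_measurable Q" using X by simp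
  have [measurable]: "(\<lambda>x :: 'a. infdist x S) \<in> borel_measurable borel"
    by (intro borel_measurable_continuous_onI continuous_intros)
  have D_meas [measurable]: "?D \<in> borel_measurable Q" by measurable
  have fm: "parallel_set S r \<in> fmeasurable lborel" for r
    by (rule fmeasurable_parallel_set [OF S])
  have P0: "parallel_set S 0 = S"
    using S compact_imp_closed parallel_set_0 by blast
  \<comment> \<open>The formula is extended to \<open>r = R\<close>, which the normalising volume of
    \<open>?A\<close> requires.\<close>
  have vol: "volume_function S r = measure lborel S + volume_increment L M r" if "0 \<le> r" "r \<le> R" for r
  proof (cases "r = R")
    case True
    have "continuous_on UNIV (\<lambda>r. measure lborel S + volume_increment L M r)"
      unfolding volume_increment_def by (intro continuous_intros)
    from volume_function_right_endpoint [OF S \<open>R > 0\<close> this vol] show ?thesis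
      using True by simp
  qed (use that vol in auto)
  have diff: "measure lborel (parallel_set S r - S) = volume_increment L M r" if "0 \<le> r" "r \<le> R" for r
  proof -
    have "measure lborel (parallel_set S r - parallel_set S 0) = volume_function S r - volume_function S 0"
      unfolding volume_function_def using that fm
      by (intro measurable_measure_Diff fmeasurableD) (auto simp: parallel_set_def)
    then show ?thesis
      using that vol [of r] vol [of 0] by (simp add: P0 volume_increment_def)
  qed
  have A: "?A \<in> fmeasurable lborel" using fmeasurable_Diff [OF fm fmeasurableD [OF fm [of 0]]] P0 by metis
  have "prob_space (distr Q lborel X)" using X by (rule Q.prob_space_distr)
  \<comment> \<open>If \<open>?A\<close> were null, \<open>uniform_measure\<close> would be the zero
    measure, since 0 / 0 = 0 in \<open>ennreal\<close>. So the law of \<open>X\<close> itself forces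
    positive volume.\<close>
  then have "emeasure (uniform_measure lborel ?A) UNIV = 1"
    unfolding X_law using prob_space.emeasure_space_1 by fastforce
  then have "emeasure lborel ?A \<noteq> 0"
    using fmeasurableD [OF A] by (auto simp: emeasure_uniform_measure)
  then have "measure lborel ?A > 0"
    using A by (simp add: emeasure_eq_measure2 ennreal_eq_0_iff zero_less_measure_iff)
  then have pos: "volume_increment L M R > 0"
    using \<open>R > 0\<close> by (simp add: diff)
  have mono: "mono_on {0..R} (volume_increment L M)"
  proof (rule mono_onI)
    fix r s assume rs: "r \<in> {0..R}" "s \<in> {0..R}" "r \<le> s"
    have "volume_function S r \<le> volume_function S s"
      unfolding volume_function_def using rs fm
      by (intro measure_mono_fmeasurable fmeasurableD) (auto simp: parallel_set_def)
    then show "volume_increment L M r \<le> volume_increment L M s"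
      using rs by (simp add: vol)
  qed
  show model: "distance_model R L M"
    by unfold_locales (use \<open>R > 0\<close> pos mono in auto)
  interpret distance_model R L M by (rule model)
  interpret \<nu>: real_distribution "distance_law R L M" by (rule real_distribution_distance_law)
  have cdf_neg: "cdf (distr Q borel ?D) r = cdf (distance_law R L M) r" if "r < 0" for r
  proof -
    have "\<not> ?D \<omega> \<le> r" for \<omega>
      using that infdist_nonneg [of "X \<omega>" S] by linarith
    then have "?D -` {..r} \<inter> space Q = {}" by auto
    then show ?thesis
      using emeasure_distance_law_atMost_neg [OF that]
      by (simp add: cdf_def measure_def emeasure_distr)
  qed
  have cdf_nonneg: "cdf (distr Q borel ?D) r = cdf (distance_law R L M) r" if "0 \<le> r" for r
  proof -
    let ?s = "min r R"
    have "cdf (distr Q borel ?D) r = measure (distr Q lborel X) (parallel_set S r)"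
      using fmeasurableD [OF fm [of r]]
      by (simp add: cdf_def measure_distr parallel_set_def vimage_def)
    also have "\<dots> = measure lborel (?A \<inter> parallel_set S r) / measure lborel ?A"
      unfolding X_law using A fm \<open>emeasure lborel ?A \<noteq> 0\<close>
      by (intro measure_uniform_measure) (auto simp: fmeasurable_def)
    also have "?A \<inter> parallel_set S r = parallel_set S ?s - S"
      by (auto simp: parallel_set_def)
    also have "measure lborel \<dots> = volume_increment L M ?s"
      using that \<open>R > 0\<close> by (intro diff) auto
    also have "measure lborel ?A = volume_increment L M R"
      using \<open>R > 0\<close> by (intro diff) auto
    finally have D: "cdf (distr Q borel ?D) r = model_cdf R L M ?s" by (simp add: model_cdf_def)
    \<comment> \<open>The value has just been identified with a probability, so the passage through
      \<open>ennreal\<close> on the other side keeps it.\<close>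
    have "0 \<le> model_cdf R L M ?s"
      using D cdf_def measure_nonneg by metis
    then show ?thesis
      using emeasure_distance_law_atMost [OF that] D by (simp add: cdf_def measure_def)
  qed
  show "distr Q borel ?D = distance_law R L M"
  proof (rule cdf_unique)
    show "real_distribution (distr Q borel ?D)" by (intro Q.real_distribution_distr D_meas)
    show "real_distribution (distance_law R L M)" by (rule real_distribution_distance_law)
    show "cdf (distr Q borel ?D) = cdf (distance_law R L M)"
      using cdf_neg cdf_nonneg by (metis ext not_le)
  qed
qed

subsection \<open>The method of moments\<close>

text \<open>\<open>q\<close> is the normalising constant without its factor \<open>R / 3\<close>.
  Orders up to four occur because the variance of the squared distance involves the fourth
  moment.\<close>

lemma model_moments_closed_form:
  assumes "R > 0" and c: "volume_increment L M R \<noteq> 0"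
  defines "q \<equiv> 4 * pi * R\<^sup>2 + 3 * M * R + 3 * L"
  shows "q \<noteq> 0"
    and "model_moment R 1 L M = R * (3 * L + 4 * M * R + 6 * pi * R\<^sup>2) / (2 * q)"
    and "model_moment R 2 L M = R\<^sup>2 * (10 * L + 15 * M * R + 24 * pi * R\<^sup>2) / (10 * q)"
    and "model_moment R 3 L M = R ^ 3 * (15 * L + 24 * M * R + 40 * pi * R\<^sup>2) / (20 * q)"
    and "model_moment R 4 L M = R ^ 4 * (21 * L + 35 * M * R + 60 * pi * R\<^sup>2) / (35 * q)"
proof -
  have c_eq: "volume_increment L M R = R * q / 3"
    by (simp add: volume_increment_def q_def algebra_simps power2_eq_square power3_eq_cube)
  then show q: "q \<noteq> 0" using c by auto
  have [simp]: "R \<noteq> 0" using \<open>R > 0\<close> by simp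
  note eqs = model_moment_eq [OF less_imp_le [OF \<open>R > 0\<close>]] partial_moment_def c_eq
  show "model_moment R 1 L M = R * (3 * L + 4 * M * R + 6 * pi * R\<^sup>2) / (2 * q)"
    unfolding eqs using q by (simp add: divide_simps) algebra
  show "model_moment R 2 L M = R\<^sup>2 * (10 * L + 15 * M * R + 24 * pi * R\<^sup>2) / (10 * q)"
    unfolding eqs using q by (simp add: divide_simps) algebra
  show "model_moment R 3 L M = R ^ 3 * (15 * L + 24 * M * R + 40 * pi * R\<^sup>2) / (20 * q)"
    unfolding eqs using q by (simp add: divide_simps) algebra
  show "model_moment R 4 L M = R ^ 4 * (21 * L + 35 * M * R + 60 * pi * R\<^sup>2) / (35 * q)"
    unfolding eqs using q by (simp add: divide_simps) algebra
qed

text \<open>Clearing \<open>c\<close> on one side and \<open>den\<close> on the other leaves linear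
  equations in \<open>L\<close> and \<open>M\<close>. Under either set of equations
  \<open>den * c\<close> is the same nonzero constant, so each side yields the nonvanishing that the
  other requires.\<close>

lemma moment_system_iff:
  assumes "R > 0"
  shows "moment_system R u v (L, M) \<longleftrightarrow>
    R\<^sup>2 - 6 * u * R + 6 * v \<noteq> 0 \<and> L = g1 R u v \<and> M = g2 R u v"
proof -
  define c where "c = volume_increment L M R"
  define den where "den = R\<^sup>2 - 6 * u * R + 6 * v"
  define K1 where "K1 = 2 * pi * R\<^sup>2 / 5 * (3 * R\<^sup>2 - 12 * u * R + 10 * v)"
  define K2 where "K2 = - (4 * pi * R / 5) * (3 * R\<^sup>2 - 16 * u * R + 15 * v)"
  define A1 where "A1 = L * R\<^sup>2 / 2 + 2 * M * R ^ 3 / 3 + pi * R ^ 4"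
  define A2 where "A2 = L * R ^ 3 / 3 + M * R ^ 4 / 2 + 4 * pi * R ^ 5 / 5"
  have c_eq: "c = L * R + M * R\<^sup>2 + 4 / 3 * pi * R ^ 3"
    by (simp add: c_def volume_increment_def)
  have m: "model_moment R 1 L M = A1 / c" "model_moment R 2 L M = A2 / c"
    using assms by (simp_all add: model_moment_eq partial_moment_def c_def A1_def A2_def
        numeral_3_eq_3 numeral_2_eq_2 eval_nat_numeral)
  have const: "2 * pi * R ^ 5 / 15 \<noteq> 0" using assms by simp
  have g: "g1 R u v = K1 / den" "g2 R u v = K2 / den"
    by (simp_all add: g1_def g2_def K1_def K2_def den_def)
  have "moment_system R u v (L, M) \<longleftrightarrow> c \<noteq> 0 \<and> u * c = A1 \<and> v * c = A2"
    by (simp only: moment_system_def prod.case m flip: c_def) (auto simp: field_simps)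
  also have "\<dots> \<longleftrightarrow> den \<noteq> 0 \<and> L * den = K1 \<and> M * den = K2"
  proof (intro iffI conjI; elim conjE)
    assume c: "c \<noteq> 0" and u: "u * c = A1" and v: "v * c = A2"
    have "den * c = R\<^sup>2 * c - 6 * R * A1 + 6 * A2"
      by (simp add: den_def algebra_simps flip: u v)
    also have "\<dots> = 2 * pi * R ^ 5 / 15"
      unfolding c_eq A1_def A2_def by (simp add: field_simps) algebra
    finally have den: "den * c = 2 * pi * R ^ 5 / 15" .
    then show "den \<noteq> 0" using const by auto
    \<comment> \<open>This integrates the unnormalised density against a polynomial orthogonal to r
      and r^2, so only \<open>L\<close> survives; in the same way \<open>K2 * c\<close> below keeps
      only \<open>M\<close>.\<close>
    have "K1 * c = 2 * pi * R\<^sup>2 / 5 * (3 * R\<^sup>2 * c - 12 * R * A1 + 10 * A2)"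
      by (simp add: K1_def algebra_simps flip: u v)
    also have "\<dots> = L * (den * c)"
      unfolding den unfolding c_eq A1_def A2_def by (simp add: field_simps) algebra
    finally show "L * den = K1" using c by (simp add: mult.assoc)
    have "K2 * c = - (4 * pi * R / 5) * (3 * R\<^sup>2 * c - 16 * R * A1 + 15 * A2)"
      by (simp add: K2_def algebra_simps flip: u v)
    also have "\<dots> = M * (den * c)"
      unfolding den unfolding c_eq A1_def A2_def by (simp add: field_simps) algebra
    finally show "M * den = K2" using c by (simp add: mult.assoc)
  next
    assume den: "den \<noteq> 0" and L: "L * den = K1" and M: "M * den = K2"
    \<comment> \<open>Here \<open>c\<close> is computed from the proposed solution. It may have
      either sign, but it cannot vanish.\<close>
    have "c * den = K1 * R + K2 * R\<^sup>2 + 4 / 3 * pi * R ^ 3 * den"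
      by (simp add: c_eq algebra_simps flip: L M)
    also have "\<dots> = 2 * pi * R ^ 5 / 15"
      unfolding K1_def K2_def den_def by (simp add: field_simps) algebra
    finally have c: "c * den = 2 * pi * R ^ 5 / 15" .
    then show "c \<noteq> 0" using const by auto
    have "A1 * den = K1 * R\<^sup>2 / 2 + 2 * K2 * R ^ 3 / 3 + pi * R ^ 4 * den"
      by (simp add: A1_def algebra_simps add_divide_distrib flip: L M)
    also have "\<dots> = u * (c * den)"
      unfolding c unfolding K1_def K2_def den_def by (simp add: field_simps) algebra
    finally show "u * c = A1" using den by (simp add: mult.assoc)
    have "A2 * den = K1 * R ^ 3 / 3 + K2 * R ^ 4 / 2 + 4 * pi * R ^ 5 / 5 * den"
      by (simp add: A2_def algebra_simps add_divide_distrib flip: L M)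
    also have "\<dots> = v * (c * den)"
      unfolding c unfolding K1_def K2_def den_def by (simp add: field_simps) algebra
    finally show "v * c = A2" using den by (simp add: mult.assoc)
  qed
  also have "\<dots> \<longleftrightarrow> den \<noteq> 0 \<and> L = g1 R u v \<and> M = g2 R u v"
    by (auto simp: g field_simps)
  finally show ?thesis by (simp add: den_def)
qed

lemma moment_system_ex1:
  assumes "R > 0" and "R\<^sup>2 - 6 * u * R + 6 * v \<noteq> 0"
  shows "\<exists>!p. moment_system R u v p"
  using assms by (auto intro!: ex1I [of _ "(g1 R u v, g2 R u v)"] simp: moment_system_iff)

text \<open>At a vanishing denominator both sides are \<open>(0, 0)\<close>, because the system has no solution
  there.\<close>

lemma moment_estimator_eq:
  assumes "R > 0"
  shows "moment_estimator R u v = (g1 R u v, g2 R u v)"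
proof (cases "R\<^sup>2 - 6 * u * R + 6 * v = 0")
  case True
  then have "\<not> moment_system R u v p" for p
    using moment_system_iff [OF assms] by (cases p) auto
  then show ?thesis using True by (auto simp: moment_estimator_def g1_def g2_def)
next
  case False
  have "(THE p. moment_system R u v p) = (g1 R u v, g2 R u v)"
    using moment_system_iff [OF assms] False
    by (intro the1_equality moment_system_ex1 [OF assms False]) auto
  then show ?thesis
    using moment_system_ex1 [OF assms False] by (simp add: moment_estimator_def)
qed

text \<open>The value is 2 pi R^5 / 15 divided by the normalising constant. It is the mean of the
  estimators' denominators, and the ratio form of the central limit theorem asks for a positive
  one.\<close>

lemma model_moments_denominator:
  assumes "R > 0" and "volume_increment L M R > 0"
  shows "R\<^sup>2 - 6 * model_moment R 1 L M * R + 6 * model_moment R 2 L M > 0"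
proof -
  define q where "q = 4 * pi * R\<^sup>2 + 3 * M * R + 3 * L"
  have "volume_increment L M R = R * q / 3"
    by (simp add: volume_increment_def q_def algebra_simps power2_eq_square power3_eq_cube)
  then have "0 < R * q" using assms(2) by simp
  then have q: "q > 0" using \<open>R > 0\<close> by (rule zero_less_mult_pos)
  have q0: "q \<noteq> 0" using q by simp
  have "R\<^sup>2 - 6 * model_moment R 1 L M * R + 6 * model_moment R 2 L M
      = R\<^sup>2 - 6 * (R * (3 * L + 4 * M * R + 6 * pi * R\<^sup>2) / (2 * q)) * R
        + 6 * (R\<^sup>2 * (10 * L + 15 * M * R + 24 * pi * R\<^sup>2) / (10 * q))"
    using assms by (simp only: model_moments_closed_form q_def)
  also have "\<dots> = 2 * pi * R ^ 4 / (5 * q)"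
    by (simp add: divide_simps q0) (unfold q_def, algebra)
  finally have "R\<^sup>2 - 6 * model_moment R 1 L M * R + 6 * model_moment R 2 L M
      = 2 * pi * R ^ 4 / (5 * q)" .
  then show ?thesis using q \<open>R > 0\<close> by simp
qed

subsection \<open>Slutsky's theorem and the central limit theorem\<close>

lemma cmod_iexp_diff_le: "cmod (iexp x - iexp y) \<le> \<bar>x - y\<bar>"
proof -
  have "iexp x - iexp y = iexp y * (iexp (x - y) - 1)"
    by (simp add: exp_add [symmetric] algebra_simps)
  then have "cmod (iexp x - iexp y) = cmod (iexp (x - y) - 1)"
    by (simp add: norm_mult)
  also have "\<dots> \<le> \<bar>x - y\<bar>"
    using iexp_approx1 [of "x - y" 0] by simp
  finally show ?thesis .
qed

text \<open>Where \<open>W\<close> and \<open>T\<close> are closer than \<open>\<delta>\<close>, the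
  Lipschitz bound for \<open>iexp\<close> applies; elsewhere two numbers of modulus one differ by at
  most 2.\<close>

lemma (in prob_space) char_distr_diff_le:
  assumes [measurable]: "random_variable borel T" "random_variable borel W" and "\<delta> \<ge> 0"
  shows "cmod (char (distr M borel W) t - char (distr M borel T) t)
    \<le> \<bar>t\<bar> * \<delta> + 2 * prob {x \<in> space M. \<delta> \<le> \<bar>W x - T x\<bar>}"
proof -
  define A where "A = {x \<in> space M. \<delta> \<le> \<bar>W x - T x\<bar>}"
  have [measurable]: "A \<in> events" unfolding A_def by measurable
  have int: "integrable M (\<lambda>x. iexp (t * f x))" if "random_variable borel f" for f :: "'a \<Rightarrow> real"
    using that by (intro integrable_iexp) auto
  have "char (distr M borel W) t - char (distr M borel T) t
      = (\<integral>x. iexp (t * W x) - iexp (t * T x) \<partial>M)"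
    using int [of W] int [of T] by (simp add: char_def integral_distr)
  also have "cmod \<dots> \<le> (\<integral>x. cmod (iexp (t * W x) - iexp (t * T x)) \<partial>M)"
    by (rule integral_norm_bound)
  also have "\<dots> \<le> (\<integral>x. \<bar>t\<bar> * \<delta> + 2 * indicator A x \<partial>M)"
  proof (rule integral_mono)
    show "integrable M (\<lambda>x. cmod (iexp (t * W x) - iexp (t * T x)))"
      using int [of W] int [of T] by (intro integrable_norm Bochner_Integration.integrable_diff) auto
    show "integrable M (\<lambda>x. \<bar>t\<bar> * \<delta> + 2 * indicator A x)"
      by (intro Bochner_Integration.integrable_add integrable_mult_right) (auto simp: emeasure_eq_measure)
    fix x assume x: "x \<in> space M"
    show "cmod (iexp (t * W x) - iexp (t * T x)) \<le> \<bar>t\<bar> * \<delta> + 2 * indicator A x"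
    proof (cases "x \<in> A")
      case True
      have "cmod (iexp (t * W x) - iexp (t * T x)) \<le> cmod (iexp (t * W x)) + cmod (iexp (t * T x))"
        by (rule norm_triangle_ineq4)
      also have "\<dots> = 2"
        using norm_exp_i_times[of "t * W x"] norm_exp_i_times[of "t * T x"] by simp
      finally have "cmod (iexp (t * W x) - iexp (t * T x)) \<le> 2" .
      moreover have "0 \<le> \<bar>t\<bar> * \<delta>" using \<open>\<delta> \<ge> 0\<close> by simp
      ultimately show ?thesis using True by simp
    next
      case False
      have "cmod (iexp (t * W x) - iexp (t * T x)) \<le> \<bar>t\<bar> * \<bar>W x - T x\<bar>"
        using cmod_iexp_diff_le [of "t * W x" "t * T x"] by (simp add: abs_mult [symmetric] algebra_simps)
      also have "\<dots> \<le> \<bar>t\<bar> * \<delta>"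
        using False x by (intro mult_left_mono) (auto simp: A_def)
      finally show ?thesis using False by simp
    qed
  qed
  also have "\<dots> = \<bar>t\<bar> * \<delta> + 2 * prob A"
    by (subst Bochner_Integration.integral_add)
       (auto simp: prob_space emeasure_eq_measure sets.Int_space_eq2)
  finally show ?thesis unfolding A_def .
qed

lemma (in prob_space) weak_conv_m_Slutsky:
  assumes rvT: "\<And>n. random_variable borel (T n)" and rvW: "\<And>n. random_variable borel (W n)"
    and "real_distribution N" and conv: "weak_conv_m (\<lambda>n. distr M borel (T n)) N"
    and prob0: "\<And>\<delta>. \<delta> > 0 \<Longrightarrow> (\<lambda>n. prob {x \<in> space M. \<delta> \<le> \<bar>W n x - T n x\<bar>}) \<longlonglongrightarrow> 0"
  shows "weak_conv_m (\<lambda>n. distr M borel (W n)) N"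
proof (rule levy_continuity)
  fix t
  have diff: "(\<lambda>n. char (distr M borel (W n)) t - char (distr M borel (T n)) t) \<longlonglongrightarrow> 0"
  proof (rule LIMSEQ_I)
    fix r :: real assume "r > 0"
    \<comment> \<open>Chosen so that each of the two terms of \<open>char_distr_diff_le\<close> is
      at most \<open>r / 2\<close>; the summand 1 covers \<open>t = 0\<close>.\<close>
    define \<delta> where "\<delta> = r / (2 * (\<bar>t\<bar> + 1))"
    have "\<delta> > 0" using \<open>r > 0\<close> by (simp add: \<delta>_def)
    have "\<bar>t\<bar> * \<delta> \<le> r / 2" using \<open>r > 0\<close> by (simp add: \<delta>_def field_simps)
    obtain n0 where n0: "\<And>n. n \<ge> n0 \<Longrightarrow> prob {x \<in> space M. \<delta> \<le> \<bar>W n x - T n x\<bar>} < r / 4"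
      using LIMSEQ_D [OF prob0 [OF \<open>\<delta> > 0\<close>], of "r / 4"] \<open>r > 0\<close> by auto
    have "cmod (char (distr M borel (W n)) t - char (distr M borel (T n)) t) < r" if "n \<ge> n0" for n
      using char_distr_diff_le [OF rvT [of n] rvW [of n], of \<delta> t] \<open>\<delta> > 0\<close> n0 [OF that]
        \<open>\<bar>t\<bar> * \<delta> \<le> r / 2\<close> by linarith
    then show "\<exists>n0. \<forall>n\<ge>n0. norm (char (distr M borel (W n)) t - char (distr M borel (T n)) t - 0) < r"
      by auto
  qed
  have "(\<lambda>n. char (distr M borel (T n)) t) \<longlonglongrightarrow> char N t"
    using rvT by (intro levy_continuity1 assms real_distribution_distr)
  from tendsto_add [OF diff this] show "(\<lambda>n. char (distr M borel (W n)) t) \<longlonglongrightarrow> char N t"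
    by simp
qed (use assms real_distribution_distr in auto)

section \<open>Normal limits of normalised sums, including variance zero\<close>

lemma real_distribution_normal_law:
  assumes "s2 \<ge> 0"
  shows "real_distribution (normal_law m s2)"
proof (cases "s2 = 0")
  case True
  have "prob_space (return borel m)" by (rule prob_space_return) simp
  then show ?thesis using True
    by (simp add: normal_law_def real_distribution_def real_distribution_axioms_def)
next
  case False
  then have "prob_space (density lborel (normal_density m (sqrt s2)))"
    using assms by (intro prob_space_normal_density) auto
  with False show ?thesis
    by (simp add: normal_law_def real_distribution_def real_distribution_axioms_def)
qed

lemma char_normal_law:
  assumes "\<sigma> > 0"
  shows "char (normal_law 0 (\<sigma>\<^sup>2)) t = char std_normal_distribution (\<sigma> * t)"
proof -
  interpret N: prob_space std_normal_distribution
    by (rule prob_space_normal_density) simp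
  have "distributed std_normal_distribution lborel (\<lambda>x. x) std_normal_density"
    by (simp add: distributed_def distr_id2)
  from N.normal_density_affine [OF this, of \<sigma> 0]
  have "distributed std_normal_distribution lborel (\<lambda>x. \<sigma> * x) (normal_density 0 \<sigma>)"
    using assms by simp
  then have "distr std_normal_distribution lborel (\<lambda>x. \<sigma> * x) = density lborel (normal_density 0 \<sigma>)"
    by (rule distributed_distr_eq_density)
  then have "normal_law 0 (\<sigma>\<^sup>2) = distr std_normal_distribution lborel (\<lambda>x. \<sigma> * x)"
    using assms by (simp add: normal_law_def)
  then show ?thesis
    by (simp add: char_def integral_distr mult_ac)
qed

text \<open>Dividing by \<open>sqrt (real n)\<close> alone gives variance zero a meaning: all
  \<open>U i\<close> then vanish almost surely and the limit is the point mass at 0. This spares a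
  proof that the asymptotic variances are positive.\<close>

lemma (in prob_space) central_limit_theorem_normal_law:
  fixes U :: "nat \<Rightarrow> 'a \<Rightarrow> real"
  assumes indep: "indep_vars (\<lambda>_. borel) U UNIV"
    and mean: "\<And>i. expectation (U i) = 0"
    and sq: "\<And>i. integrable M (\<lambda>x. (U i x)\<^sup>2)"
    and var: "\<And>i. expectation (\<lambda>x. (U i x)\<^sup>2) = s2"
    and dist: "\<And>i. distr M borel (U i) = \<nu>"
  shows "weak_conv_m (\<lambda>n. distr M borel (\<lambda>x. (\<Sum>i<n. U i x) / sqrt (real n))) (normal_law 0 s2)"
proof -
  have rv [measurable]: "random_variable borel (U i)" for i
    using indep by (auto simp: indep_vars_def)
  have "s2 \<ge> 0" by (subst var [of 0, symmetric]) simp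
  let ?T = "\<lambda>n x. (\<Sum>i<n. U i x) / sqrt (real n)"
  show ?thesis
  proof (rule levy_continuity)
    show "real_distribution (distr M borel (?T n))" for n
      by (rule real_distribution_distr) measurable
    show "real_distribution (normal_law 0 s2)"
      using \<open>s2 \<ge> 0\<close> by (rule real_distribution_normal_law)
    fix t
    show "(\<lambda>n. char (distr M borel (?T n)) t) \<longlonglongrightarrow> char (normal_law 0 s2) t"
    proof (cases "s2 = 0")
      case True
      have "AE x in M. U i x = 0" for i
        using integral_nonneg_eq_0_iff_AE [OF sq [of i]] var [of i] True by auto
      then have "AE x in M. \<forall>i. U i x = 0" by (simp add: AE_all_countable)
      then have "AE x in M. iexp (t * ?T n x) = 1" for n by eventually_elim simp
      then have "(\<integral>x. iexp (t * ?T n x) \<partial>M) = (\<integral>x. 1 \<partial>M)" for n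
        by (intro integral_cong_AE) auto
      then have "char (distr M borel (?T n)) t = (\<integral>x. 1 \<partial>M)" for n
        by (simp add: char_def integral_distr)
      moreover have "char (normal_law 0 s2) t = 1"
        using True by (simp add: char_def normal_law_def integral_return)
      ultimately show ?thesis by (simp add: prob_space)
    next
      case False
      define \<sigma> where "\<sigma> = sqrt s2"
      have \<sigma>: "\<sigma> > 0" "\<sigma>\<^sup>2 = s2" using False \<open>s2 \<ge> 0\<close> by (auto simp: \<sigma>_def)
      have "weak_conv_m (\<lambda>n. distr M borel (\<lambda>x. (\<Sum>i<n. U i x) / sqrt (real n * \<sigma>\<^sup>2)))
          std_normal_distribution"
        using \<sigma> by (intro central_limit_theorem_zero_mean [OF indep mean _ sq _ dist])
           (simp_all add: mean var)
      then have "(\<lambda>n. char (distr M borel (\<lambda>x. (\<Sum>i<n. U i x) / sqrt (real n * \<sigma>\<^sup>2))) (\<sigma> * t))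
          \<longlonglongrightarrow> char std_normal_distribution (\<sigma> * t)"
        by (intro levy_continuity1 real_distribution_distr real_dist_normal_dist) measurable
      \<comment> \<open>The extra factor \<open>\<sigma>\<close> in the denominator is undone by
        evaluating at \<open>\<sigma> * t\<close>.\<close>
      moreover have "char (distr M borel (\<lambda>x. (\<Sum>i<n. U i x) / sqrt (real n * \<sigma>\<^sup>2))) (\<sigma> * t)
          = char (distr M borel (?T n)) t" for n
        using \<sigma>(1) by (simp add: char_def integral_distr real_sqrt_mult)
      ultimately show ?thesis
        using char_normal_law [OF \<sigma>(1), of t] \<sigma>(2) by simp
    qed
  qed
qed

lemma (in prob_space) second_moment_sum:
  fixes U :: "nat \<Rightarrow> 'a \<Rightarrow> real"
  assumes indep: "indep_vars (\<lambda>_. borel) U UNIV"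
    and mean: "\<And>i. expectation (U i) = 0"
    and sq: "\<And>i. integrable M (\<lambda>x. (U i x)\<^sup>2)"
    and var: "\<And>i. expectation (\<lambda>x. (U i x)\<^sup>2) = s2"
  shows "integrable M (\<lambda>x. (\<Sum>i<n. U i x)\<^sup>2) \<and> expectation (\<lambda>x. (\<Sum>i<n. U i x)\<^sup>2) = real n * s2"
proof (induction n)
  case 0
  show ?case by simp
next
  case (Suc n)
  have rv [measurable]: "random_variable borel (U i)" for i
    using indep by (auto simp: indep_vars_def)
  have int: "integrable M (U i)" for i
    by (rule square_integrable_imp_integrable [OF rv sq])
  \<comment> \<open>Independence of the new summand from the partial sum makes the cross term
    vanish, because both are centred.\<close>
  have ind: "indep_var borel (U n) borel (\<lambda>x. \<Sum>i<n. U i x)"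
    by (rule indep_vars_sum) (auto intro: indep_vars_subset [OF indep])
  have intS: "integrable M (\<lambda>x. \<Sum>i<n. U i x)" using int by auto
  have prod: "integrable M (\<lambda>x. U n x * (\<Sum>i<n. U i x))"
    by (rule indep_var_integrable [OF ind int intS])
  have prod0: "expectation (\<lambda>x. U n x * (\<Sum>i<n. U i x)) = 0"
    using indep_var_lebesgue_integral [OF ind int intS] by (simp add: mean)
  have eq: "(\<Sum>i<Suc n. U i x)\<^sup>2
      = (\<Sum>i<n. U i x)\<^sup>2 + 2 * (U n x * (\<Sum>i<n. U i x)) + (U n x)\<^sup>2" for x
    by (simp add: power2_sum algebra_simps)
  show ?case
    unfolding eq using Suc prod prod0 sq [of n] var [of n]
    by (simp add: algebra_simps)
qed

text \<open>Let \<open>T\<close> be the normalised sum of the \<open>U i\<close> and \<open>B\<close> the mean of the \<open>V i\<close>.  The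
  sequence below differs from \<open>T\<close> by \<open>T (b - B) / B\<close>.  Where \<open>\<bar>B - b\<bar> < b / 2\<close> this is
  at most \<open>(T\<^sup>2 + n (B - b)\<^sup>2) / (b \<surd>n)\<close>, which is of order \<open>1 / \<surd>n\<close> in the mean.\<close>

lemma (in prob_space) central_limit_theorem_ratio:
  fixes U V :: "nat \<Rightarrow> 'a \<Rightarrow> real"
  assumes indepU: "indep_vars (\<lambda>_. borel) U UNIV"
    and meanU: "\<And>i. expectation (U i) = 0"
    and sqU: "\<And>i. integrable M (\<lambda>x. (U i x)\<^sup>2)"
    and varU: "\<And>i. expectation (\<lambda>x. (U i x)\<^sup>2) = s2"
    and dist: "\<And>i. distr M borel (U i) = \<nu>"
    and indepV: "indep_vars (\<lambda>_. borel) V UNIV"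
    and meanV: "\<And>i. expectation (V i) = b" and "b > 0"
    and sqV: "\<And>i. integrable M (\<lambda>x. (V i x)\<^sup>2)"
    and varV: "\<And>i. variance (V i) = v"
  shows "weak_conv_m (\<lambda>n. distr M borel
      (\<lambda>x. sqrt (real n) * (sample_mean U n x * b / sample_mean V n x))) (normal_law 0 s2)"
proof (rule weak_conv_m_Slutsky)
  have [measurable]: "random_variable borel (U i)" "random_variable borel (V i)" for i
    using indepU indepV by (auto simp: indep_vars_def)
  define T where "T n x = (\<Sum>i<n. U i x) / sqrt (real n)" for n x
  define B where "B = sample_mean V"
  define W where "W n x = sqrt (real n) * (sample_mean U n x * b / B n x)" for n x
  define Z where "Z n x = (T n x)\<^sup>2 + real n * (B n x - b)\<^sup>2" for n x
  have [measurable]: "random_variable borel (T n)" "random_variable borel (B n)"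
      "random_variable borel (W n)" for n
    unfolding T_def B_def W_def sample_mean_def by measurable
  show "random_variable borel (\<lambda>x. (\<Sum>i<n. U i x) / sqrt (real n))" for n by measurable
  show "random_variable borel (\<lambda>x. sqrt (real n) * (sample_mean U n x * b / sample_mean V n x))" for n
    unfolding sample_mean_def by measurable
  have "s2 \<ge> 0" by (subst varU [of 0, symmetric]) simp
  then show "real_distribution (normal_law 0 s2)" by (rule real_distribution_normal_law)
  show "weak_conv_m (\<lambda>n. distr M borel (\<lambda>x. (\<Sum>i<n. U i x) / sqrt (real n))) (normal_law 0 s2)"
    by (rule central_limit_theorem_normal_law [OF indepU meanU sqU varU dist])
  have "v \<ge> 0" by (subst varV [of 0, symmetric]) simp
  have intV: "integrable M (V i)" for i
    by (rule square_integrable_imp_integrable [OF _ sqV]) simp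
  have sqV': "integrable M (\<lambda>x. (V i x - b)\<^sup>2)" for i
  proof -
    have "(V i x - b)\<^sup>2 = (V i x)\<^sup>2 - 2 * b * V i x + b\<^sup>2" for x
      by (simp add: power2_diff)
    then show ?thesis using sqV [of i] intV [of i] by simp
  qed
  have sumV: "integrable M (\<lambda>x. (\<Sum>i<n. V i x - b)\<^sup>2) \<and>
      expectation (\<lambda>x. (\<Sum>i<n. V i x - b)\<^sup>2) = real n * v" for n
  proof (rule second_moment_sum)
    show "indep_vars (\<lambda>_. borel) (\<lambda>i x. V i x - b) UNIV"
      by (rule indep_vars_compose2 [OF indepV, of "\<lambda>_ y. y - b"]) auto
    show "expectation (\<lambda>x. V i x - b) = 0" for i
      using intV [of i] meanV [of i] by (simp add: prob_space)
  qed (use sqV' varV meanV in auto)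
  note sumU = second_moment_sum [OF indepU meanU sqU varU]
  have Bdev: "B n x - b = (\<Sum>i<n. V i x - b) / real n" if "n > 0" for n x
    using that by (simp add: B_def sample_mean_def sum_subtractf field_simps)
  have Z_eq: "Z n x = (\<Sum>i<n. U i x)\<^sup>2 / real n + (\<Sum>i<n. V i x - b)\<^sup>2 / real n" if "n > 0" for n x
    using that unfolding Z_def Bdev [OF that] T_def by (simp add: power_divide field_simps power2_eq_square)
  have Z_nonneg: "0 \<le> Z n x" for n x by (simp add: Z_def)
  \<comment> \<open>Both parts of \<open>Z n\<close> are squares of normalised centred sums, so the
    mean does not grow with \<open>n\<close>.\<close>
  have intZ: "integrable M (Z n)" and expZ: "expectation (Z n) = s2 + v" if "n > 0" for n
    using that sumU [of n] sumV [of n] by (auto simp: Z_eq [OF that, abs_def])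
  fix \<delta> :: real assume "\<delta> > 0"
  have bound: "prob {x \<in> space M. \<delta> \<le> \<bar>W n x - T n x\<bar>}
      \<le> (s2 + v) / (\<delta> * b * sqrt (real n)) + 4 * (s2 + v) / (real n * b\<^sup>2)" if "n > 0" for n
  proof -
    let ?A = "{x \<in> space M. \<delta> * b * sqrt (real n) \<le> Z n x}"
    let ?C = "{x \<in> space M. real n * b\<^sup>2 / 4 \<le> Z n x}"
    have [measurable]: "random_variable borel (Z n)" unfolding Z_def by measurable
    have "{x \<in> space M. \<delta> \<le> \<bar>W n x - T n x\<bar>} \<subseteq> ?A \<union> ?C"
    proof (rule subsetI, rule UnCI)
      fix x assume "x \<in> {x \<in> space M. \<delta> \<le> \<bar>W n x - T n x\<bar>}" and "x \<notin> ?C"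
      then have x: "x \<in> space M" "\<delta> \<le> \<bar>W n x - T n x\<bar>" "\<not> real n * b\<^sup>2 / 4 \<le> Z n x"
        by auto
      \<comment> \<open>Outside \<open>?C\<close> the denominator stays above \<open>b / 2\<close>,
        so division by it costs at most a factor \<open>2 / b\<close>.\<close>
      have "real n * (B n x - b)\<^sup>2 < real n * b\<^sup>2 / 4"
        using x(3) unfolding Z_def by (smt (verit) zero_le_power2)
      then have "(B n x - b)\<^sup>2 < (b / 2)\<^sup>2" using that by (simp add: power_divide)
      then have "\<bar>B n x - b\<bar> < b / 2" using \<open>b > 0\<close>
        by (metis abs_of_pos half_gt_zero power2_less_imp_less power2_abs less_imp_le)
      then have B: "B n x > b / 2" by linarith
      have "sqrt (real n) / real n = 1 / sqrt (real n)"
        using that real_div_sqrt [of "real n"] by (simp add: field_simps)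
      then have "sqrt (real n) * sample_mean U n x = T n x"
        unfolding T_def sample_mean_def by (metis mult.commute times_divide_eq_left times_divide_eq_right mult_1)
      then have "W n x = T n x * b / B n x"
        by (simp add: W_def)
      then have "W n x - T n x = T n x * (b - B n x) / B n x"
        using B \<open>b > 0\<close> by (simp add: field_simps)
      then have "\<delta> \<le> \<bar>T n x * (b - B n x)\<bar> / B n x"
        using x(2) B \<open>b > 0\<close> by (simp only: abs_divide abs_of_pos)
      then have "\<delta> * B n x \<le> \<bar>T n x * (b - B n x)\<bar>"
        using B \<open>b > 0\<close> by (subst (asm) pos_le_divide_eq) auto
      moreover have "\<delta> * (b / 2) \<le> \<delta> * B n x" using B \<open>\<delta> > 0\<close> by simp
      ultimately have "\<delta> * b \<le> 2 * (\<bar>T n x\<bar> * \<bar>b - B n x\<bar>)" by (simp add: abs_mult)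
      then have "\<delta> * b * sqrt (real n) \<le> 2 * (\<bar>T n x\<bar> * \<bar>b - B n x\<bar>) * sqrt (real n)"
        by (intro mult_right_mono) auto
      also have "\<dots> = 2 * \<bar>T n x\<bar> * (sqrt (real n) * \<bar>b - B n x\<bar>)" by simp
      also have "\<dots> \<le> \<bar>T n x\<bar>\<^sup>2 + (sqrt (real n) * \<bar>b - B n x\<bar>)\<^sup>2"
        by (rule sum_squares_bound)
      also have "\<dots> = Z n x"
        by (simp add: Z_def power_mult_distrib power2_commute)
      finally show "x \<in> ?A" using x(1) by simp
    qed
    then have "prob {x \<in> space M. \<delta> \<le> \<bar>W n x - T n x\<bar>} \<le> prob (?A \<union> ?C)"
      by (intro finite_measure_mono) measurable
    also have "\<dots> \<le> prob ?A + prob ?C"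
      by (intro measure_Un_le) measurable
    also have "prob ?A \<le> expectation (Z n) / (\<delta> * b * sqrt (real n))"
      using that \<open>\<delta> > 0\<close> \<open>b > 0\<close> intZ [OF that]
      by (intro integral_Markov_inequality_measure [where A = "{}"]) (auto simp: Z_nonneg)
    also have "prob ?C \<le> expectation (Z n) / (real n * b\<^sup>2 / 4)"
      using that \<open>b > 0\<close> intZ [OF that]
      by (intro integral_Markov_inequality_measure [where A = "{}"]) (auto simp: Z_nonneg)
    finally show ?thesis unfolding expZ [OF that] by (simp add: mult.commute)
  qed
  have "(\<lambda>n. prob {x \<in> space M. \<delta> \<le> \<bar>W n x - T n x\<bar>}) \<longlonglongrightarrow> 0"
  proof (rule tendsto_sandwich [OF _ _ tendsto_const])
    show "\<forall>\<^sub>F n in sequentially. prob {x \<in> space M. \<delta> \<le> \<bar>W n x - T n x\<bar>}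
      \<le> (s2 + v) / (\<delta> * b) * inverse (sqrt (real n)) + 4 * (s2 + v) / b\<^sup>2 * inverse (real n)"
      using eventually_gt_at_top [of 0] by eventually_elim (use bound in \<open>auto simp: field_simps\<close>)
    have "(\<lambda>n. inverse (sqrt (real n))) \<longlonglongrightarrow> 0"
      by (intro tendsto_inverse_0_at_top filterlim_compose [OF sqrt_at_top filterlim_real_sequentially])
    then have "(\<lambda>n. (s2 + v) / (\<delta> * b) * inverse (sqrt (real n)) + 4 * (s2 + v) / b\<^sup>2 * inverse (real n))
        \<longlonglongrightarrow> (s2 + v) / (\<delta> * b) * 0 + 4 * (s2 + v) / b\<^sup>2 * 0"
      by (intro tendsto_add tendsto_mult tendsto_const lim_inverse_n)
    then show "(\<lambda>n. (s2 + v) / (\<delta> * b) * inverse (sqrt (real n)) + 4 * (s2 + v) / b\<^sup>2 * inverse (real n))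
        \<longlonglongrightarrow> 0" by simp
  qed auto
  then show "(\<lambda>n. prob {x \<in> space M.
      \<delta> \<le> \<bar>sqrt (real n) * (sample_mean U n x * b / sample_mean V n x) - (\<Sum>i<n. U i x) / sqrt (real n)\<bar>})
      \<longlonglongrightarrow> 0"
    by (simp add: W_def T_def B_def)
qed

text \<open>Fix the sum \<open>z\<close> of the other variables: \<open>Y 0\<close> takes the value
  \<open>c - z\<close> with probability zero. Independence and Fubini integrate this over
  \<open>z\<close>.\<close>

lemma (in prob_space) AE_sum_indep_neq:
  fixes Y :: "nat \<Rightarrow> 'a \<Rightarrow> real"
  assumes indep: "indep_vars (\<lambda>_. borel) Y UNIV"
    and diffuse: "\<And>a. AE x in M. Y 0 x \<noteq> a" and "n \<ge> 1"
  shows "AE x in M. (\<Sum>i<n. Y i x) \<noteq> c"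
proof -
  define Z where "Z x = (\<Sum>i\<in>{1..<n}. Y i x)" for x
  have ind: "indep_var borel (Y 0) borel Z"
    unfolding Z_def by (rule indep_vars_sum) (auto intro: indep_vars_subset [OF indep])
  then have [measurable]: "random_variable borel (Y 0)" "random_variable borel Z"
    by (auto dest: indep_var_rv1 indep_var_rv2)
  have joint: "distr M borel (Y 0) \<Otimes>\<^sub>M distr M borel Z = distr M (borel \<Otimes>\<^sub>M borel) (\<lambda>x. (Y 0 x, Z x))"
    using ind by (simp add: indep_var_distribution_eq)
  interpret Y: prob_space "distr M borel (Y 0)" by (rule prob_space_distr) measurable
  interpret Z: prob_space "distr M borel Z" by (rule prob_space_distr) measurable
  interpret YZ: pair_sigma_finite "distr M borel (Y 0)" "distr M borel Z" ..
  have "AE y in distr M borel (Y 0). y + z \<noteq> c" for z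
    using diffuse [of "c - z"] by (subst AE_distr_iff) (auto simp: algebra_simps)
  then have "AE z in distr M borel Z. AE y in distr M borel (Y 0). y + z \<noteq> c" by simp
  \<comment> \<open>Diffuseness gives a null set in \<open>y\<close> for each \<open>z\<close>,
    while \<open>AE_pair_measure\<close> expects the first coordinate outermost.\<close>
  then have "AE y in distr M borel (Y 0). AE z in distr M borel Z. y + z \<noteq> c"
    by (subst YZ.AE_commute) measurable
  moreover have "(\<lambda>p. fst p + snd p) \<in> borel_measurable (distr M borel (Y 0) \<Otimes>\<^sub>M distr M borel Z)"
    by measurable
  ultimately have "AE p in distr M borel (Y 0) \<Otimes>\<^sub>M distr M borel Z. fst p + snd p \<noteq> c"
    by (intro YZ.AE_pair_measure borel_measurable_neq) simp_all
  then have "AE x in M. Y 0 x + Z x \<noteq> c"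
    unfolding joint by (subst (asm) AE_distr_iff) auto
  moreover have "(\<Sum>i<n. Y i x) = Y 0 x + Z x" for x
    using \<open>n \<ge> 1\<close> by (simp add: Z_def sum.atLeast_Suc_lessThan flip: atLeast0LessThan)
  ultimately show ?thesis by simp
qed

subsection \<open>The delta method for linear fractional functions\<close>

lemma inner_vec2: "x \<bullet> y = x $ 1 * y $ 1 + x $ 2 * y $ 2" for x y :: "real ^ 2"
  by (simp add: inner_vec_def sum_2)

lemma GDERIV_linear_fractional:
  fixes x :: "real ^ 2" and a0 a1 a2 b0 b1 b2 :: real
  defines "N \<equiv> a0 + a1 * x $ 1 + a2 * x $ 2" and "D \<equiv> b0 + b1 * x $ 1 + b2 * x $ 2"
  assumes "D \<noteq> 0"
  shows "GDERIV (\<lambda>x. (a0 + a1 * x $ 1 + a2 * x $ 2) / (b0 + b1 * x $ 1 + b2 * x $ 2)) x :>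
    vector [(a1 * D - N * b1) / D\<^sup>2, (a2 * D - N * b2) / D\<^sup>2]"
proof -
  have nth: "((\<lambda>x :: real ^ 2. x $ i) has_derivative (\<lambda>h. h $ i)) (at x)" for i
    by (rule bounded_linear.has_derivative [OF bounded_linear_vec_nth has_derivative_ident])
  have "((\<lambda>x. (a0 + a1 * x $ 1 + a2 * x $ 2) / (b0 + b1 * x $ 1 + b2 * x $ 2)) has_derivative
      (\<lambda>h. ((a1 * h $ 1 + a2 * h $ 2) * D - N * (b1 * h $ 1 + b2 * h $ 2)) / (D * D))) (at x)"
    using assms by (auto intro!: derivative_eq_intros nth simp: D_def N_def)
  then show ?thesis
    unfolding gderiv_def
    by (rule has_derivative_eq_rhs)
       (auto simp: inner_vec2 fun_eq_iff power2_eq_square algebra_simps add_divide_distrib diff_divide_distrib)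
qed

section \<open>Covariances and quadratic forms\<close>

lemma (in prob_space) integrable_product_of_square_integrable:
  fixes U V :: "'a \<Rightarrow> real"
  assumes [measurable]: "random_variable borel U" "random_variable borel V"
    and "integrable M (\<lambda>x. (U x)\<^sup>2)" and "integrable M (\<lambda>x. (V x)\<^sup>2)"
  shows "integrable M (\<lambda>x. U x * V x)"
proof (rule Bochner_Integration.integrable_bound)
  show "integrable M (\<lambda>x. (U x)\<^sup>2 + (V x)\<^sup>2)" using assms by simp
  have "\<bar>U x * V x\<bar> \<le> (U x)\<^sup>2 + (V x)\<^sup>2" for x
  proof -
    have "2 * (\<bar>U x\<bar> * \<bar>V x\<bar>) \<le> (U x)\<^sup>2 + (V x)\<^sup>2"
      using sum_squares_bound [of "\<bar>U x\<bar>" "\<bar>V x\<bar>"] by simp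
    moreover have "0 \<le> \<bar>U x\<bar> * \<bar>V x\<bar>" by simp
    ultimately show ?thesis unfolding abs_mult by linarith
  qed
  then show "AE x in M. norm (U x * V x) \<le> norm ((U x)\<^sup>2 + (V x)\<^sup>2)" by simp
qed measurable

text \<open>Links the scalar central limit theorem, which produces the variance of a single linear
  combination, with the form gradient, covariance matrix, gradient.\<close>

lemma (in prob_space) inner_covariance_matrix:
  fixes U V :: "'a \<Rightarrow> real"
  assumes [measurable]: "random_variable borel U" "random_variable borel V"
    and sq: "integrable M (\<lambda>x. (U x - expectation U)\<^sup>2)" "integrable M (\<lambda>x. (V x - expectation V)\<^sup>2)"
  shows "d \<bullet> (covariance_matrix M (\<lambda>x. vector [U x, V x] :: real ^ 2) *v d)
    = expectation (\<lambda>x. (d $ 1 * (U x - expectation U) + d $ 2 * (V x - expectation V))\<^sup>2)"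
proof -
  define A B where "A x = U x - expectation U" and "B x = V x - expectation V" for x
  have [measurable]: "random_variable borel A" "random_variable borel B"
    unfolding A_def B_def by measurable
  have sq: "integrable M (\<lambda>x. (A x)\<^sup>2)" "integrable M (\<lambda>x. (B x)\<^sup>2)"
    using sq by (simp_all add: A_def B_def)
  then have prod: "integrable M (\<lambda>x. A x * B x)"
    by (intro integrable_product_of_square_integrable) auto
  have cov: "covariance M U U = expectation (\<lambda>x. (A x)\<^sup>2)"
    "covariance M U V = expectation (\<lambda>x. A x * B x)"
    "covariance M V U = expectation (\<lambda>x. A x * B x)"
    "covariance M V V = expectation (\<lambda>x. (B x)\<^sup>2)"
    by (simp_all add: covariance_def A_def B_def power2_eq_square mult.commute)
  have "(d $ 1 * A x + d $ 2 * B x)\<^sup>2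
      = (d $ 1)\<^sup>2 * (A x)\<^sup>2 + 2 * d $ 1 * d $ 2 * (A x * B x) + (d $ 2)\<^sup>2 * (B x)\<^sup>2" for x
    by (simp add: power2_sum power_mult_distrib algebra_simps)
  then have "expectation (\<lambda>x. (d $ 1 * A x + d $ 2 * B x)\<^sup>2)
      = (d $ 1)\<^sup>2 * expectation (\<lambda>x. (A x)\<^sup>2) + 2 * d $ 1 * d $ 2 * expectation (\<lambda>x. A x * B x)
        + (d $ 2)\<^sup>2 * expectation (\<lambda>x. (B x)\<^sup>2)"
    using sq prod by simp
  also have "\<dots> = d \<bullet> (covariance_matrix M (\<lambda>x. vector [U x, V x] :: real ^ 2) *v d)"
    by (simp add: inner_vec2 matrix_vector_mult_def sum_2 covariance_matrix_def cov
        power2_eq_square algebra_simps)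
  finally show ?thesis by (simp add: A_def B_def)
qed

text \<open>For linear fractional \<open>f\<close> with denominator \<open>E\<close> the first order expansion at \<open>p\<close> is
  exact up to a factor: \<open>f y - f p = (\<nabla>f p \<bullet> (y - p)) E p / E y\<close>.  There is no remainder to
  estimate, and the ratio form of the central limit theorem applies directly.\<close>

lemma (in prob_space) linear_fractional_delta_method:
  fixes Y :: "nat \<Rightarrow> 'a \<Rightarrow> real" and f :: "real \<Rightarrow> real \<Rightarrow> real"
  assumes f: "f = (\<lambda>u v. (a0 + a1 * u + a2 * v) / (b0 + b1 * u + b2 * v))"
    and indep: "indep_vars (\<lambda>_. borel) Y UNIV"
    and law: "\<And>i. distr M borel (Y i) = \<nu>"
    and moments: "\<And>k. k \<le> 4 \<Longrightarrow> integrable \<nu> (\<lambda>x. x ^ k)"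
  defines "m1 \<equiv> \<integral>x. x \<partial>\<nu>" and "m2 \<equiv> \<integral>x. x\<^sup>2 \<partial>\<nu>"
    and "m \<equiv> sample_mean Y" and "s \<equiv> sample_mean (\<lambda>i \<omega>. (Y i \<omega>)\<^sup>2)"
  assumes den_pos: "b0 + b1 * m1 + b2 * m2 > 0"
    and den: "\<And>n. n \<ge> 1 \<Longrightarrow> AE \<omega> in M. b0 + b1 * m n \<omega> + b2 * s n \<omega> \<noteq> 0"
  defines "d \<equiv> gradient (\<lambda>x :: real ^ 2. f (x $ 1) (x $ 2)) (vector [m1, m2])"
  shows "weak_conv_m (\<lambda>n. distr M borel (\<lambda>\<omega>. sqrt (real n) * (f (m n \<omega>) (s n \<omega>) - f m1 m2)))
    (normal_law 0 (\<integral>x. (d $ 1 * (x - m1) + d $ 2 * (x\<^sup>2 - m2))\<^sup>2 \<partial>\<nu>))"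
proof -
  define N D where "N = a0 + a1 * m1 + a2 * m2" and "D = b0 + b1 * m1 + b2 * m2"
  have "D > 0" using den_pos by (simp add: D_def)
  have d_eq: "d = vector [(a1 * D - N * b1) / D\<^sup>2, (a2 * D - N * b2) / D\<^sup>2]"
    using GDERIV_linear_fractional [of b0 b1 "vector [m1, m2]" b2 a0 a1 a2] \<open>D > 0\<close>
    unfolding d_def f by (intro gradient_eqI) (simp add: N_def D_def)
  have d: "d $ 1 = (a1 * D - N * b1) / D\<^sup>2" "d $ 2 = (a2 * D - N * b2) / D\<^sup>2"
    by (simp_all add: d_eq)
  \<comment> \<open>Contributions of a single observation: \<open>h\<close> averages to the linear
    part of the expansion, \<open>k\<close> to the denominator at the sample moments. Their means
    are 0 and \<open>D\<close>.\<close>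
  define h where "h x = d $ 1 * (x - m1) + d $ 2 * (x\<^sup>2 - m2)" for x
  define k where "k x = b0 + b1 * x + b2 * x\<^sup>2" for x
  have [measurable]: "random_variable borel (Y i)" for i
    using indep by (auto simp: indep_vars_def)
  have [measurable]: "h \<in> borel_measurable borel" "k \<in> borel_measurable borel"
    unfolding h_def k_def by measurable
  interpret \<nu>: prob_space \<nu>
    unfolding law [of 0, symmetric] by (rule prob_space_distr) measurable
  have sets_\<nu> [measurable_cong, simp]: "sets \<nu> = sets borel"
    by (simp flip: law [of 0])
  have int_Y: "expectation (\<lambda>\<omega>. p (Y i \<omega>)) = (\<integral>x. p x \<partial>\<nu>)"
    and integrable_Y: "integrable M (\<lambda>\<omega>. p (Y i \<omega>)) \<longleftrightarrow> integrable \<nu> p"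
    if [measurable]: "p \<in> borel_measurable borel" for p :: "real \<Rightarrow> real" and i
    by (simp_all add: integral_distr integrable_distr_eq flip: law [of i])
  note int_simps = moments [of 1, simplified] moments [of 2, simplified]
  \<comment> \<open>Both \<open>h\<close> and \<open>k\<close> are quadratic, so their squares use
    moments up to order four.\<close>
  have sq: "integrable \<nu> (\<lambda>x. (\<alpha> + \<beta> * x + \<gamma> * x\<^sup>2)\<^sup>2)" for \<alpha> \<beta> \<gamma>
  proof -
    have expand: "(\<alpha> + \<beta> * x + \<gamma> * x\<^sup>2)\<^sup>2 = \<alpha>\<^sup>2 * x ^ 0 + 2 * \<alpha> * \<beta> * x ^ 1 + (\<beta>\<^sup>2 + 2 * \<alpha> * \<gamma>) * x ^ 2
        + 2 * \<beta> * \<gamma> * x ^ 3 + \<gamma>\<^sup>2 * x ^ 4" for x by algebra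
    show ?thesis
      unfolding expand
      by (intro Bochner_Integration.integrable_add integrable_mult_right moments) simp_all
  qed
  have h_sq: "integrable \<nu> (\<lambda>x. (h x)\<^sup>2)"
    using sq [of "- d $ 1 * m1 - d $ 2 * m2" "d $ 1" "d $ 2"] by (simp add: h_def algebra_simps)
  have k_sq: "integrable \<nu> (\<lambda>x. (k x)\<^sup>2)"
    unfolding k_def by (rule sq)
  have h_mean: "(\<integral>x. h x \<partial>\<nu>) = 0"
    using int_simps by (simp add: h_def m1_def m2_def \<nu>.prob_space)
  have k_mean: "(\<integral>x. k x \<partial>\<nu>) = D"
    using int_simps by (simp add: k_def D_def m1_def m2_def \<nu>.prob_space)
  let ?W = "\<lambda>n \<omega>. sqrt (real n) * (sample_mean (\<lambda>i \<omega>. h (Y i \<omega>)) n \<omega> * D / sample_mean (\<lambda>i \<omega>. k (Y i \<omega>)) n \<omega>)"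
  have "weak_conv_m (\<lambda>n. distr M borel (?W n)) (normal_law 0 (\<integral>x. (h x)\<^sup>2 \<partial>\<nu>))"
  proof (rule central_limit_theorem_ratio)
    show "indep_vars (\<lambda>_. borel) (\<lambda>i \<omega>. h (Y i \<omega>)) UNIV"
      by (rule indep_vars_compose2 [OF indep, of "\<lambda>_. h"]) measurable
    show "indep_vars (\<lambda>_. borel) (\<lambda>i \<omega>. k (Y i \<omega>)) UNIV"
      by (rule indep_vars_compose2 [OF indep, of "\<lambda>_. k"]) measurable
    show "expectation (\<lambda>\<omega>. h (Y i \<omega>)) = 0" for i using int_Y [of h i] h_mean by simp
    show "expectation (\<lambda>\<omega>. k (Y i \<omega>)) = D" for i using int_Y [of k i] k_mean by simp
    show "integrable M (\<lambda>\<omega>. (h (Y i \<omega>))\<^sup>2)" for i using integrable_Y [of "\<lambda>x. (h x)\<^sup>2" i] h_sq by simp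
    show "integrable M (\<lambda>\<omega>. (k (Y i \<omega>))\<^sup>2)" for i using integrable_Y [of "\<lambda>x. (k x)\<^sup>2" i] k_sq by simp
    show "expectation (\<lambda>\<omega>. (h (Y i \<omega>))\<^sup>2) = (\<integral>x. (h x)\<^sup>2 \<partial>\<nu>)" for i
      using int_Y [of "\<lambda>x. (h x)\<^sup>2" i] by simp
    show "variance (\<lambda>\<omega>. k (Y i \<omega>)) = (\<integral>x. (k x - D)\<^sup>2 \<partial>\<nu>)" for i
      using int_Y [of k i] int_Y [of "\<lambda>x. (k x - D)\<^sup>2" i] k_mean by simp
    show "distr M borel (\<lambda>\<omega>. h (Y i \<omega>)) = distr \<nu> borel h" for i
      by (simp add: distr_distr comp_def flip: law [of i])
    show "D > 0" by fact
  qed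
  moreover have "distr M borel (\<lambda>\<omega>. sqrt (real n) * (f (m n \<omega>) (s n \<omega>) - f m1 m2)) = distr M borel (?W n)" for n
  proof (cases "n = 0")
    \<comment> \<open>The factor \<open>sqrt (real n)\<close> makes both sides 0.\<close>
    case True
    then show ?thesis by simp
  next
    case False
    have eq: "f (m n \<omega>) (s n \<omega>) - f m1 m2
        = sample_mean (\<lambda>i \<omega>. h (Y i \<omega>)) n \<omega> * D / sample_mean (\<lambda>i \<omega>. k (Y i \<omega>)) n \<omega>"
      if "b0 + b1 * m n \<omega> + b2 * s n \<omega> \<noteq> 0" for \<omega>
    proof -
      define E where "E = b0 + b1 * m n \<omega> + b2 * s n \<omega>"
      define u v where "u = m n \<omega> - m1" and "v = s n \<omega> - m2"
      have "E \<noteq> 0" using that by (simp add: E_def)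
      have 1: "sample_mean (\<lambda>i \<omega>. h (Y i \<omega>)) n \<omega> = d $ 1 * u + d $ 2 * v"
        using False by (simp add: sample_mean_def h_def u_def v_def m_def s_def sum.distrib
            sum_subtractf field_simps flip: sum_distrib_left)
      have 2: "sample_mean (\<lambda>i \<omega>. k (Y i \<omega>)) n \<omega> = E"
        using False by (simp add: sample_mean_def k_def E_def m_def s_def sum.distrib
            field_simps flip: sum_distrib_left)
      have num: "a0 + a1 * m n \<omega> + a2 * s n \<omega> = N + a1 * u + a2 * v"
        by (simp add: N_def u_def v_def algebra_simps)
      have E_eq: "E = D + b1 * u + b2 * v"
        by (simp add: E_def D_def u_def v_def algebra_simps)
      \<comment> \<open>By \<open>E_eq\<close>, the terms in \<open>b1\<close> and \<open>b2\<close>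
        add up to \<open>- N / D * (E - D)\<close>; dividing by \<open>E\<close> leaves exactly the
        difference of two values of \<open>f\<close>.\<close>
      have "(d $ 1 * u + d $ 2 * v) * D = ((a1 * D - N * b1) * u + (a2 * D - N * b2) * v) / D"
        using \<open>D > 0\<close> by (simp add: d field_simps power2_eq_square)
      also have "\<dots> = (N + a1 * u + a2 * v) - N / D * E"
        using \<open>D > 0\<close> by (simp add: E_eq field_simps)
      finally have "(d $ 1 * u + d $ 2 * v) * D / E = (N + a1 * u + a2 * v) / E - N / D"
        using \<open>E \<noteq> 0\<close> by (simp add: diff_divide_distrib)
      then show ?thesis
        by (simp add: f 1 2 num flip: E_def N_def D_def)
    qed
    show ?thesis
    \<comment> \<open>At a vanishing denominator both quotients are 0 by convention, and the sides
      may differ by the term \<open>f m1 m2\<close>; so the identity is only almost sure.\<close>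
    proof (rule distr_cong_AE)
      show "AE \<omega> in M. sqrt (real n) * (f (m n \<omega>) (s n \<omega>) - f m1 m2) = ?W n \<omega>"
        using den [of n] False by (auto elim!: eventually_mono simp: eq)
      show "random_variable borel (\<lambda>\<omega>. sqrt (real n) * (f (m n \<omega>) (s n \<omega>) - f m1 m2))"
        unfolding f m_def s_def sample_mean_def by measurable
      show "random_variable borel (?W n)"
        unfolding sample_mean_def by measurable
    qed auto
  qed
  ultimately show ?thesis by (simp add: h_def)
qed

text \<open>Differences are written as sums with negated coefficients so that the right-hand side
  matches the pattern \<open>a0 + a1 * u + a2 * v\<close> by unification; the same applies to
  \<open>g2\<close>.\<close>

lemma g1_eq_linear_fractional: "g1 R = (\<lambda>u v. (2 * pi * R\<^sup>2 / 5 * (3 * R\<^sup>2) + - (2 * pi * R\<^sup>2 / 5 * (12 * R)) * u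
    + 2 * pi * R\<^sup>2 / 5 * 10 * v) / (R\<^sup>2 + (- 6 * R) * u + 6 * v))"
proof (intro ext)
  fix u v
  have "2 * pi * R\<^sup>2 / 5 * (3 * R\<^sup>2 - 12 * u * R + 10 * v) = 2 * pi * R\<^sup>2 / 5 * (3 * R\<^sup>2)
      + - (2 * pi * R\<^sup>2 / 5 * (12 * R)) * u + 2 * pi * R\<^sup>2 / 5 * 10 * v"
    by (simp add: field_simps)
  moreover have "R\<^sup>2 - 6 * u * R + 6 * v = R\<^sup>2 + (- 6 * R) * u + 6 * v" by simp
  ultimately show "g1 R u v = (2 * pi * R\<^sup>2 / 5 * (3 * R\<^sup>2) + - (2 * pi * R\<^sup>2 / 5 * (12 * R)) * u
    + 2 * pi * R\<^sup>2 / 5 * 10 * v) / (R\<^sup>2 + (- 6 * R) * u + 6 * v)"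
    by (simp only: g1_def times_divide_eq_right)
qed

lemma g2_eq_linear_fractional: "g2 R = (\<lambda>u v. (- (4 * pi * R / 5) * (3 * R\<^sup>2) + 4 * pi * R / 5 * (16 * R) * u
    + - (4 * pi * R / 5 * 15) * v) / (R\<^sup>2 + (- 6 * R) * u + 6 * v))"
proof (intro ext)
  fix u v
  have "- (4 * pi * R / 5) * (3 * R\<^sup>2 - 16 * u * R + 15 * v) = - (4 * pi * R / 5) * (3 * R\<^sup>2)
      + 4 * pi * R / 5 * (16 * R) * u + - (4 * pi * R / 5 * 15) * v"
    by (simp add: field_simps)
  moreover have "R\<^sup>2 - 6 * u * R + 6 * v = R\<^sup>2 + (- 6 * R) * u + 6 * v" by simp
  ultimately show "g2 R u v = (- (4 * pi * R / 5) * (3 * R\<^sup>2) + 4 * pi * R / 5 * (16 * R) * u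
    + - (4 * pi * R / 5 * 15) * v) / (R\<^sup>2 + (- 6 * R) * u + 6 * v)"
    by (simp only: g2_def times_divide_eq_right)
qed

text \<open>The first two conjuncts tie the parametric moments at \<open>(L0, M)\<close> to the true
  moments of the distance; they justify reading \<open>moment_system\<close> as the equations of the
  method of moments.\<close>

theorem theorem3:
  fixes R L0 M :: real
    and S :: "(real ^ 3) set"
    and Q :: "'b measure" and X :: "'b \<Rightarrow> real ^ 3"
    and P :: "'a measure" and Ds :: "nat \<Rightarrow> 'a \<Rightarrow> real"
  assumes "R > 0"
    and "compact S" and "S \<noteq> {}"
    and "\<And>r. 0 \<le> r \<Longrightarrow> r < R \<Longrightarrow>
           volume_function S r = measure lborel S + L0 * r + M * r^2 + 4/3 * pi * r^3"
    and "prob_space Q" and "X \<in> measurable Q lborel"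
    and "distr Q lborel X = uniform_measure lborel (parallel_set S R - S)"
    and "prob_space P" and "prob_space.indep_vars P (\<lambda>_. borel) Ds UNIV"
    and "\<And>i. distr P borel (Ds i) = distr Q borel (\<lambda>\<omega>. infdist (X \<omega>) S)"
  shows
    "let D = (\<lambda>\<omega>. infdist (X \<omega>) S);
         ED = prob_space.expectation Q D;
         ED2 = prob_space.expectation Q (\<lambda>\<omega>. (D \<omega>)^2);
         m1 = sample_mean Ds;
         m2 = sample_mean (\<lambda>i \<omega>. (Ds i \<omega>)^2);
         L_est = (\<lambda>n \<omega>. fst (moment_estimator R (m1 n \<omega>) (m2 n \<omega>)));
         M_est = (\<lambda>n \<omega>. snd (moment_estimator R (m1 n \<omega>) (m2 n \<omega>)));
         \<Sigma> = covariance_matrix Q (\<lambda>\<omega>. vector [D \<omega>, (D \<omega>)^2] :: real ^ 2);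
         e = (vector [ED, ED2] :: real ^ 2);
         grad1 = gradient (\<lambda>x :: real ^ 2. g1 R (x $ 1) (x $ 2)) e;
         grad2 = gradient (\<lambda>x :: real ^ 2. g2 R (x $ 1) (x $ 2)) e
     in
       ED = model_moment R 1 L0 M \<and>
       ED2 = model_moment R 2 L0 M \<and>
       (\<forall>n\<ge>1. AE \<omega> in P. R^2 - 6 * m1 n \<omega> * R + 6 * m2 n \<omega> \<noteq> 0) \<and>
       (\<forall>n\<ge>1. \<forall>\<omega>\<in>space P. R^2 - 6 * m1 n \<omega> * R + 6 * m2 n \<omega> \<noteq> 0 \<longrightarrow>
          (\<exists>!p. moment_system R (m1 n \<omega>) (m2 n \<omega>) p) \<and>
          L_est n \<omega> = g1 R (m1 n \<omega>) (m2 n \<omega>) \<and>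
          M_est n \<omega> = g2 R (m1 n \<omega>) (m2 n \<omega>)) \<and>
       weak_conv_m (\<lambda>n. distr P borel (\<lambda>\<omega>. sqrt (real n) * (L_est n \<omega> - L0)))
         (normal_law 0 (grad1 \<bullet> (\<Sigma> *v grad1))) \<and>
       weak_conv_m (\<lambda>n. distr P borel (\<lambda>\<omega>. sqrt (real n) * (M_est n \<omega> - M)))
         (normal_law 0 (grad2 \<bullet> (\<Sigma> *v grad2))) \<and>
       prob_space.variance Q D =
         R^2 * (12 * pi^2 * R^4 + 24 * pi * M * R^3 + 10 * M^2 * R^2 + 44 * pi * L0 * R^2
                + 30 * L0 * M * R + 15 * L0^2)
         / (20 * (4 * pi * R^2 + 3 * M * R + 3 * L0)^2) \<and>
       prob_space.variance Q (\<lambda>\<omega>. (D \<omega>)^2) =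
         R^4 * (768 * pi^2 * R^4 + 1360 * pi * M * R^3 + 525 * M^2 * R^2 + 1920 * pi * L0 * R^2
                + 1260 * L0 * M * R + 560 * L0^2)
         / (700 * (4 * pi * R^2 + 3 * M * R + 3 * L0)^2) \<and>
       covariance Q D (\<lambda>\<omega>. (D \<omega>)^2) =
         R^3 * (16 * pi^2 * R^4 + 30 * pi * M * R^3 + 12 * M^2 * R^2 + 48 * pi * L0 * R^2
                + 32 * L0 * M * R + 15 * L0^2)
         / (20 * (4 * pi * R^2 + 3 * M * R + 3 * L0)^2)"
proof -
  interpret Q: prob_space Q by fact
  interpret P: prob_space P by fact
  let ?D = "\<lambda>\<omega>. infdist (X \<omega>) S"
  let ?ED = "Q.expectation ?D" and ?ED2 = "Q.expectation (\<lambda>\<omega>. (?D \<omega>)\<^sup>2)"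
  let ?m = "sample_mean Ds" and ?s = "sample_mean (\<lambda>i \<omega>. (Ds i \<omega>)\<^sup>2)"
  let ?\<Sigma> = "covariance_matrix Q (\<lambda>\<omega>. vector [?D \<omega>, (?D \<omega>)\<^sup>2] :: real ^ 2)"
  let ?e = "vector [?ED, ?ED2] :: real ^ 2"
  have vol: "volume_function S r = measure lborel S + volume_increment L0 M r" if "0 \<le> r" "r < R" for r
    using assms(4) [OF that] by (simp add: volume_increment_def)
  note model = distance_distribution [OF assms(1-3) vol assms(5-7)]
  interpret distance_model R L0 M by (rule model(1))
  define \<nu> where "\<nu> = distance_law R L0 M"
  interpret \<nu>: real_distribution \<nu>
    unfolding \<nu>_def by (rule real_distribution_distance_law)
  have law_Q: "distr Q borel ?D = \<nu>" using model(2) by (simp add: \<nu>_def)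
  have law_P: "distr P borel (Ds i) = \<nu>" for i using assms(10) law_Q by simp
  have [measurable]: "X \<in> borel_measurable Q" using assms(6) by simp
  have [measurable]: "(\<lambda>x :: real ^ 3. infdist x S) \<in> borel_measurable borel"
    by (intro borel_measurable_continuous_onI continuous_intros)
  have D_meas [measurable]: "?D \<in> borel_measurable Q" by measurable
  have Ds_meas [measurable]: "P.random_variable borel (Ds i)" for i
    using assms(9) by (auto simp: P.indep_vars_def)
  have mom: "integrable \<nu> (\<lambda>x. x ^ k)" "(\<integral>x. x ^ k \<partial>\<nu>) = model_moment R k L0 M" for k
    using has_bochner_integral_distance_law [of k] unfolding \<nu>_def
    by (auto simp: has_bochner_integral_iff)
  have int_Q: "Q.expectation (\<lambda>\<omega>. p (?D \<omega>)) = (\<integral>x. p x \<partial>\<nu>)"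
    and integrable_Q: "integrable Q (\<lambda>\<omega>. p (?D \<omega>)) \<longleftrightarrow> integrable \<nu> p"
    if [measurable]: "p \<in> borel_measurable borel" for p :: "real \<Rightarrow> real"
    by (simp_all add: integral_distr integrable_distr_eq flip: law_Q)
  have D_pow: "integrable Q (\<lambda>\<omega>. ?D \<omega> ^ k)" "Q.expectation (\<lambda>\<omega>. ?D \<omega> ^ k) = model_moment R k L0 M" for k
    using mom [of k] int_Q [of "\<lambda>x. x ^ k"] integrable_Q [of "\<lambda>x. x ^ k"] by simp_all
  have ED: "?ED = model_moment R 1 L0 M" using D_pow(2) [of 1] by simp
  have ED2: "?ED2 = model_moment R 2 L0 M" by (rule D_pow(2))
  note cf = model_moments_closed_form [OF \<open>R > 0\<close> less_imp_neq [OF increment_pos, symmetric]]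
  have den_pos: "R\<^sup>2 - 6 * ?ED * R + 6 * ?ED2 > 0"
    unfolding ED ED2 using model_moments_denominator [OF \<open>R > 0\<close> increment_pos] .
  have g_ED: "L0 = g1 R ?ED ?ED2" "M = g2 R ?ED ?ED2"
  proof -
    \<comment> \<open>The true parameters solve the system at the true moments, so uniqueness
      identifies them with the values of \<open>g1\<close> and \<open>g2\<close> there. These are
      the centring constants of the limit theorem.\<close>
    have "moment_system R ?ED ?ED2 (L0, M)"
      using increment_pos by (simp add: moment_system_def ED ED2)
    then show "L0 = g1 R ?ED ?ED2" "M = g2 R ?ED ?ED2"
      using moment_system_iff [OF \<open>R > 0\<close>] by blast+
  qed
  have AE_den: "AE \<omega> in P. R\<^sup>2 - 6 * ?m n \<omega> * R + 6 * ?s n \<omega> \<noteq> 0" if "n \<ge> 1" for n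
  proof -
    \<comment> \<open>The denominator is the sample mean of these independent variables, and a
      quadratic in a diffuse variable is diffuse.\<close>
    let ?Y = "\<lambda>i \<omega>. R\<^sup>2 - 6 * R * Ds i \<omega> + 6 * (Ds i \<omega>)\<^sup>2"
    have diffuse: "AE \<omega> in P. ?Y 0 \<omega> \<noteq> a" for a
    proof -
      \<comment> \<open>From completing the square. For a negative radicand there is no root, and
        the two listed points do no harm.\<close>
      let ?t = "sqrt ((a - R\<^sup>2) / 6 + R\<^sup>2 / 4)"
      have roots: "x \<in> {R / 2 + ?t, R / 2 - ?t}" if "R\<^sup>2 - 6 * R * x + 6 * x\<^sup>2 = a" for x
      proof -
        have "(x - R / 2)\<^sup>2 = (a - R\<^sup>2) / 6 + R\<^sup>2 / 4"
          using that by (simp add: field_simps power2_eq_square)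
        then have "\<bar>x - R / 2\<bar> = ?t" by (metis real_sqrt_abs)
        then show ?thesis by auto
      qed
      have "AE x in \<nu>. x \<notin> {R / 2 + ?t, R / 2 - ?t}"
        unfolding \<nu>_def by (intro AE_not_in finite_imp_null_set_distance_law) simp
      then have "AE x in \<nu>. R\<^sup>2 - 6 * R * x + 6 * x\<^sup>2 \<noteq> a"
        by (rule eventually_mono) (use roots in blast)
      then show ?thesis
        unfolding law_P [of 0, symmetric] by (subst (asm) AE_distr_iff) auto
    qed
    have "AE \<omega> in P. (\<Sum>i<n. ?Y i \<omega>) \<noteq> 0"
      using that diffuse
      by (intro P.AE_sum_indep_neq P.indep_vars_compose2 [OF assms(9), of "\<lambda>_ x. R\<^sup>2 - 6 * R * x + 6 * x\<^sup>2"]) auto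
    moreover have "(\<Sum>i<n. ?Y i \<omega>) = real n * (R\<^sup>2 - 6 * ?m n \<omega> * R + 6 * ?s n \<omega>)" for \<omega>
      using that by (simp add: sample_mean_def sum.distrib sum_subtractf sum_distrib_left field_simps)
    ultimately show ?thesis by simp
  qed
  \<comment> \<open>Stated for an arbitrary numerator, since both estimators share the
    denominator.\<close>
  have conv: "weak_conv_m (\<lambda>n. distr P borel (\<lambda>\<omega>. sqrt (real n) * (f (?m n \<omega>) (?s n \<omega>) - f ?ED ?ED2)))
      (normal_law 0 (gradient (\<lambda>x :: real ^ 2. f (x $ 1) (x $ 2)) ?e
        \<bullet> (?\<Sigma> *v gradient (\<lambda>x :: real ^ 2. f (x $ 1) (x $ 2)) ?e)))"
    if f: "f = (\<lambda>u v. (a0 + a1 * u + a2 * v) / (R\<^sup>2 + (- 6 * R) * u + 6 * v))" for f a0 a1 a2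
  proof -
    let ?d = "gradient (\<lambda>x :: real ^ 2. f (x $ 1) (x $ 2)) ?e"
    have \<nu>_ED: "(\<integral>x. x \<partial>\<nu>) = ?ED" "(\<integral>x. x\<^sup>2 \<partial>\<nu>) = ?ED2"
      using mom(2) [of 1] mom(2) [of 2] ED ED2 by simp_all
    have "weak_conv_m (\<lambda>n. distr P borel (\<lambda>\<omega>. sqrt (real n) * (f (?m n \<omega>) (?s n \<omega>) - f ?ED ?ED2)))
      (normal_law 0 (\<integral>x. (?d $ 1 * (x - ?ED) + ?d $ 2 * (x\<^sup>2 - ?ED2))\<^sup>2 \<partial>\<nu>))"
      using P.linear_fractional_delta_method [OF f assms(9) law_P mom(1)] den_pos AE_den
      unfolding \<nu>_ED by (simp add: algebra_simps)
    also have "(\<integral>x. (?d $ 1 * (x - ?ED) + ?d $ 2 * (x\<^sup>2 - ?ED2))\<^sup>2 \<partial>\<nu>)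
        = Q.expectation (\<lambda>\<omega>. (?d $ 1 * (?D \<omega> - ?ED) + ?d $ 2 * ((?D \<omega>)\<^sup>2 - ?ED2))\<^sup>2)"
      by (rule int_Q [symmetric]) measurable
    also have "\<dots> = ?d \<bullet> (?\<Sigma> *v ?d)"
    proof (rule Q.inner_covariance_matrix [symmetric])
      have "integrable Q (\<lambda>\<omega>. (?D \<omega>)\<^sup>2 - 2 * ?ED * ?D \<omega> + ?ED\<^sup>2)"
        using D_pow(1) [of 1] D_pow(1) [of 2] by simp
      then show "integrable Q (\<lambda>\<omega>. (?D \<omega> - ?ED)\<^sup>2)"
        by (simp add: power2_diff algebra_simps)
      have "integrable Q (\<lambda>\<omega>. ?D \<omega> ^ 4 - 2 * ?ED2 * (?D \<omega>)\<^sup>2 + ?ED2\<^sup>2)"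
        using D_pow(1) [of 2] D_pow(1) [of 4] by simp
      then show "integrable Q (\<lambda>\<omega>. ((?D \<omega>)\<^sup>2 - ?ED2)\<^sup>2)"
        by (simp add: power2_diff algebra_simps flip: power_mult)
    qed measurable
    finally show ?thesis .
  qed
  define q where "q = 4 * pi * R\<^sup>2 + 3 * M * R + 3 * L0"
  have q: "q \<noteq> 0" using cf(1) by (simp add: q_def)
  note cf = cf(2-5) [folded q_def]
  \<comment> \<open>One identity for all entries of the covariance matrix: \<open>(i, j)\<close>
    will be (1, 1), (2, 2) and (1, 2).\<close>
  have cov_eq: "Q.expectation (\<lambda>\<omega>. (?D \<omega> ^ i - model_moment R i L0 M) * (?D \<omega> ^ j - model_moment R j L0 M))
      = model_moment R (i + j) L0 M - model_moment R i L0 M * model_moment R j L0 M" for i j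
  proof -
    have "(?D \<omega> ^ i - model_moment R i L0 M) * (?D \<omega> ^ j - model_moment R j L0 M)
        = ?D \<omega> ^ (i + j) - model_moment R j L0 M * ?D \<omega> ^ i - model_moment R i L0 M * ?D \<omega> ^ j
          + model_moment R i L0 M * model_moment R j L0 M" for \<omega>
      by (simp add: algebra_simps power_add)
    then show ?thesis
      using D_pow [of i] D_pow [of j] D_pow [of "i + j"] by (simp add: Q.prob_space)
  qed
  have var_D: "Q.variance ?D =
         R^2 * (12 * pi^2 * R^4 + 24 * pi * M * R^3 + 10 * M^2 * R^2 + 44 * pi * L0 * R^2
                + 30 * L0 * M * R + 15 * L0^2)
         / (20 * (4 * pi * R^2 + 3 * M * R + 3 * L0)^2)"
  proof -
    have "Q.variance ?D = model_moment R 2 L0 M - model_moment R 1 L0 M * model_moment R 1 L0 M"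
      using cov_eq [of 1 1] by (simp add: ED power2_eq_square flip: numeral_2_eq_2)
    then show ?thesis
      unfolding cf by (simp add: divide_simps q flip: q_def) (unfold q_def, algebra)
  qed
  have var_D2: "Q.variance (\<lambda>\<omega>. (?D \<omega>)^2) =
         R^4 * (768 * pi^2 * R^4 + 1360 * pi * M * R^3 + 525 * M^2 * R^2 + 1920 * pi * L0 * R^2
                + 1260 * L0 * M * R + 560 * L0^2)
         / (700 * (4 * pi * R^2 + 3 * M * R + 3 * L0)^2)"
  proof -
    have "Q.variance (\<lambda>\<omega>. (?D \<omega>)^2) = model_moment R 4 L0 M - model_moment R 2 L0 M * model_moment R 2 L0 M"
      using cov_eq [of 2 2] unfolding ED2 by (simp add: power2_eq_square [of "_ - _"])
    then show ?thesis
      unfolding cf by (simp add: divide_simps q flip: q_def) (unfold q_def, algebra)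
  qed
  have cov: "covariance Q ?D (\<lambda>\<omega>. (?D \<omega>)^2) =
         R^3 * (16 * pi^2 * R^4 + 30 * pi * M * R^3 + 12 * M^2 * R^2 + 48 * pi * L0 * R^2
                + 32 * L0 * M * R + 15 * L0^2)
         / (20 * (4 * pi * R^2 + 3 * M * R + 3 * L0)^2)"
  proof -
    have "covariance Q ?D (\<lambda>\<omega>. (?D \<omega>)^2) = model_moment R 3 L0 M - model_moment R 1 L0 M * model_moment R 2 L0 M"
      using cov_eq [of 1 2] by (simp add: ED ED2 covariance_def flip: numeral_3_eq_3)
    then show ?thesis
      unfolding cf by (simp add: divide_simps q flip: q_def) (unfold q_def, algebra)
  qed
  have conv1: "weak_conv_m (\<lambda>n. distr P borel (\<lambda>\<omega>. sqrt (real n) * (g1 R (?m n \<omega>) (?s n \<omega>) - L0)))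
      (normal_law 0 (gradient (\<lambda>x :: real ^ 2. g1 R (x $ 1) (x $ 2)) ?e
        \<bullet> (?\<Sigma> *v gradient (\<lambda>x :: real ^ 2. g1 R (x $ 1) (x $ 2)) ?e)))"
    using conv [OF g1_eq_linear_fractional] by (simp only: flip: g_ED(1))
  have conv2: "weak_conv_m (\<lambda>n. distr P borel (\<lambda>\<omega>. sqrt (real n) * (g2 R (?m n \<omega>) (?s n \<omega>) - M)))
      (normal_law 0 (gradient (\<lambda>x :: real ^ 2. g2 R (x $ 1) (x $ 2)) ?e
        \<bullet> (?\<Sigma> *v gradient (\<lambda>x :: real ^ 2. g2 R (x $ 1) (x $ 2)) ?e)))"
    using conv [OF g2_eq_linear_fractional] by (simp only: flip: g_ED(2))
  show ?thesis
    \<comment> \<open>\<open>moment_estimator_eq\<close> holds at every sample, degenerate ones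
      included, so the estimators are replaced by \<open>g1\<close> and \<open>g2\<close> without an
      exceptional set.\<close>
    unfolding Let_def moment_estimator_eq [OF \<open>R > 0\<close>] fst_conv snd_conv
    using ED ED2 AE_den moment_system_ex1 [OF \<open>R > 0\<close>] conv1 conv2 var_D var_D2 cov
    by (intro conjI) blast+
qed

end
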